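(* Let $m\in\mathbb{N}$, let $A=\langle a\rangle\le \mathrm{Sym}(3)$ with $a=(1\,2\,3)$, so $A\cong\mathbb{Z}/3\mathbb{Z}$, and let $B=(\mathbb{Z}/3\mathbb{Z})^m$. Let $\omega=\omega_0\omega_1\omega_2\dots$ be a sequence of epimorphisms $\omega_i\colon B\to A$ such that $\bigcap_{i\ge k}\ker(\omega_i)=\{1\}$ for every $k\in\mathbb{N}$, and let $G_\omega=\langle A,B_\omega\rangle\le\mathrm{Aut}(T_3)$ be the associated spinal group. If there exists $l\in\mathbb{N}$ such that $\bigcap_{i=k}^{k+l}\ker(\omega_i)=\{1\}$ for infinitely many $k\in\mathbb{N}$, then $G_\omega$ is of subexponential growth.
   Context: $T_3$ is the $3$-regular rooted tree with vertex set the finite words over $\{1,2,3\}$. Elements of $\mathrm{Sym}(3)$ act as rooted automorphisms: $\tau(xw)=\tau(x)w$. For $g$ fixing the first level, $g=(g_1,g_2,g_3)$ means that $g$ acts on the subtree rooted at vertex $i$ as $g_i$ (via the natural identification of that subtree with $T_3$). Let $\sigma$ denote the left shift $\sigma(\omega_0\omega_1\omega_2\dots)=\omega_1\omega_2\dots$. For each such sequence $\omega$, define recursively the injective homomorphism $\beta_\omega\colon B\to\mathrm{Aut}(T_3)$ by $\beta_\omega(b)=(\omega_0(b),1,\beta_{\sigma(\omega)}(b))$, where $\omega_0(b)\in A$ is regarded as a rooted automorphism, and set $B_\omega=\beta_\omega(B)$. Subexponential growth: for non-decreasing $f,g\colon\mathbb{N}\to\mathbb{N}$ write $f\lesssim g$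 if there is $C\in\mathbb{N}_{>0}$ with $f(n)\le g(Cn)$ for all $n\ge1$, and $f\sim g$ if $f\lesssim g$ and $g\lesssim f$; a finitely generated group is of subexponential growth if its word growth function $\gamma$ (with respect to a finite symmetric generating set) satisfies $\gamma\lesssim e^n$ but $\gamma\not\sim e^n$. *)

theory Defs
  imports Complex_Main
begin

datatype letter = L1 | L2 | L3

fun rot :: "letter \<Rightarrow> letter" where
  "rot L1 = L2" | "rot L2 = L3" | "rot L3 = L1"

fun rooted :: "nat \<Rightarrow> letter list \<Rightarrow> letter list" where
  "rooted k [] = []"
| "rooted k (x # w) = (rot ^^ k) x # w"

section \<open>B = (Z/3Z)^m and A = <a> = Z/3Z (written additively via exponents)\<close>

definition Bset :: "nat \<Rightarrow> (nat \<Rightarrow> nat) set" where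
  "Bset m = {b. (\<forall>j<m. b j < 3) \<and> (\<forall>j\<ge>m. b j = 0)}"

definition addB :: "(nat \<Rightarrow> nat) \<Rightarrow> (nat \<Rightarrow> nat) \<Rightarrow> (nat \<Rightarrow> nat)" where
  "addB b c = (\<lambda>j. (b j + c j) mod 3)"

definition zeroB :: "nat \<Rightarrow> nat" where
  "zeroB = (\<lambda>j. 0)"

text \<open>An epimorphism B -> A, with A identified with Z/3Z via k |-> a^k.\<close>
definition is_epi :: "nat \<Rightarrow> ((nat \<Rightarrow> nat) \<Rightarrow> nat) \<Rightarrow> bool" where
  "is_epi m f \<longleftrightarrow> (\<forall>b\<in>Bset m. f b < 3)
     \<and> (\<forall>b\<in>Bset m. \<forall>c\<in>Bset m. f (addB b c) = (f b + f c) mod 3)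
     \<and> f ` Bset m = {0, 1, 2}"

definition kerB :: "nat \<Rightarrow> ((nat \<Rightarrow> nat) \<Rightarrow> nat) \<Rightarrow> (nat \<Rightarrow> nat) set" where
  "kerB m f = {b \<in> Bset m. f b = 0}"

text \<open>beta omega n b is beta_{sigma^n(omega)}(b):
  beta_omega(b) = (omega_0(b), 1, beta_{sigma omega}(b)).\<close>
fun beta :: "(nat \<Rightarrow> (nat \<Rightarrow> nat) \<Rightarrow> nat) \<Rightarrow> nat \<Rightarrow> (nat \<Rightarrow> nat)
              \<Rightarrow> letter list \<Rightarrow> letter list" where
  "beta \<omega> n b [] = []"
| "beta \<omega> n b (L1 # w) = L1 # rooted (\<omega> n b) w"
| "beta \<omega> n b (L2 # w) = L2 # w"
| "beta \<omega> n b (L3 # w) = L3 # beta \<omega> (Suc n) b w"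

text \<open>Finite symmetric generating set of G_omega = <A, B_omega>:
  the nontrivial elements of A and of B_omega.\<close>
definition spinal_gens :: "nat \<Rightarrow> (nat \<Rightarrow> (nat \<Rightarrow> nat) \<Rightarrow> nat)
                            \<Rightarrow> (letter list \<Rightarrow> letter list) set" where
  "spinal_gens m \<omega> = {rooted 1, rooted 2} \<union> {beta \<omega> 0 b | b. b \<in> Bset m \<and> b \<noteq> zeroB}"

definition ball :: "('a \<Rightarrow> 'a) set \<Rightarrow> nat \<Rightarrow> ('a \<Rightarrow> 'a) set" where
  "ball S n = {foldr (\<circ>) gs id | gs. set gs \<subseteq> S \<and> length gs \<le> n}"

definition growth :: "('a \<Rightarrow> 'a) set \<Rightarrow> nat \<Rightarrow> real" where
  "growth S n = real (card (ball S n))"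

definition growth_le :: "(nat \<Rightarrow> real) \<Rightarrow> (nat \<Rightarrow> real) \<Rightarrow> bool" where
  "growth_le f g \<longleftrightarrow> (\<exists>C::nat. C > 0 \<and> (\<forall>n\<ge>1. f n \<le> g (C * n)))"

definition growth_equiv :: "(nat \<Rightarrow> real) \<Rightarrow> (nat \<Rightarrow> real) \<Rightarrow> bool" where
  "growth_equiv f g \<longleftrightarrow> growth_le f g \<and> growth_le g f"

definition subexponential_growth :: "('a \<Rightarrow> 'a) set \<Rightarrow> bool" where
  "subexponential_growth S \<longleftrightarrow>
     growth_le (growth S) (\<lambda>n. exp (real n)) \<and> \<not> growth_equiv (growth S) (\<lambda>n. exp (real n))"

end

theory Submission
  imports Defs
begin

text \<open>
  An element is written as a product of conjugates, by powers of \<open>a\<close>, of elements of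
  \<open>B\<close>. The total length of its sections at any depth is at most its length; call it incompressible
  at depth \<open>d\<close> if it is equal. In an incompressible word the sequence of conjugating exponents
  is a descending run followed by an ascending one. Along a run, the values of the first
  epimorphism can be read off the exponents in the three sections, which are again incompressible;
  so, up to polynomially many choices, the first \<open>l + 1\<close> epimorphisms are determined on every
  letter. If their kernels intersect trivially, there are polynomially many incompressible words at
  depth \<open>l + 2\<close>, with a bound that does not depend on the position of the window.

  Cutting a word greedily into incompressible pieces, either there are few pieces, and hence few
  words, or the total length of the sections drops by a fixed factor. If \<open>R\<close> is the supremum over all
  shifts of \<open>\<omega>\<close> of the exponential growth rates, this gives
  \<open>R \<le> max (1 + \<epsilon>) (R powr (1 - 1/N))\<close> with \<open>N\<close> depending only on \<open>\<epsilon>\<close>, so that \<open>R = 1\<close>;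
  shifts that do not start a window are harmless since rates do not decrease under the shift.
\<close>

section \<open>Letters, words and evaluation\<close>

lemma rot_rot_rot [simp]: "rot (rot (rot x)) = x"
  by (cases x) auto

lemma rot_neq [simp]: "rot x \<noteq> x" "x \<noteq> rot x" "rot (rot x) \<noteq> x" "x \<noteq> rot (rot x)"
  by (cases x; simp)+

lemma rot_eq_iff [simp]: "rot x = rot y \<longleftrightarrow> x = y"
  by (cases x; cases y) auto

lemma UNIV_letter: "(UNIV :: letter set) = {L1, L2, L3}"
  using letter.exhaust by auto

lemma finite_letters [simp]: "finite (A :: letter set)"
  by (rule finite_subset[OF subset_UNIV]) (simp add: UNIV_letter)

lemma card_letters: "card (UNIV :: letter set) = 3"
  by (simp add: UNIV_letter)

lemma rot_pow_3 [simp]: "(rot ^^ (3 * k)) x = x"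
  by (induction k) (auto simp: numeral_3_eq_3)

lemma rot_pow_mod: "(rot ^^ (k mod 3)) x = (rot ^^ k) x"
proof -
  have "(rot ^^ k) x = (rot ^^ (k mod 3 + 3 * (k div 3))) x"
    by simp
  then show ?thesis
    by (simp only: funpow_add comp_apply rot_pow_3)
qed

lemma rot_pow_eqD:
  assumes "(rot ^^ i) q = (rot ^^ j) q" "i < 3" "j < 3"
  shows "i = j"
proof -
  have "i \<in> {0, 1, 2}" "j \<in> {0, 1, 2}"
    using assms(2,3) by auto
  then show ?thesis
    using assms(1) by (auto simp: numeral_2_eq_2)
qed

lemma rooted_0 [simp]: "rooted 0 = id"
proof
  show "rooted 0 v = id v" for v by (cases v) auto
qed

lemma rooted_rooted: "rooted j (rooted k v) = rooted (j + k) v"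
  by (cases v) (auto simp: funpow_add)

lemma rooted_mod: "rooted (k mod 3) = rooted k"
proof
  show "rooted (k mod 3) v = rooted k v" for v by (cases v) (auto simp: rot_pow_mod)
qed

lemma inj_rot_pow: "(rot ^^ e) x = (rot ^^ e) y \<longleftrightarrow> x = y"
  by (induction e) auto

lemma rot_rot_pow: "rot ((rot ^^ e) x) = (rot ^^ e) (rot x)"
  by (simp add: funpow_swap1)

fun on_subtrees :: "(letter \<Rightarrow> letter list \<Rightarrow> letter list) \<Rightarrow> letter list \<Rightarrow> letter list" where
  "on_subtrees f [] = []"
| "on_subtrees f (x # v) = x # f x v"

lemma addB_in: "addB b c \<in> Bset m" if "b \<in> Bset m" "c \<in> Bset m"
  using that by (auto simp: Bset_def addB_def)

lemma Bset_subset_image: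
  "Bset m \<subseteq> (\<lambda>xs j. if j < m then xs ! j else 0) ` {xs. set xs \<subseteq> {..<3} \<and> length xs = m}"
proof
  fix b assume b: "b \<in> Bset m"
  then have "b = (\<lambda>j. if j < m then map b [0..<m] ! j else 0)"
    by (auto simp: Bset_def fun_eq_iff)
  moreover have "map b [0..<m] \<in> {xs. set xs \<subseteq> {..<3} \<and> length xs = m}"
    using b by (auto simp: Bset_def)
  ultimately show "b \<in> (\<lambda>xs j. if j < m then xs ! j else 0) ` {xs. set xs \<subseteq> {..<3} \<and> length xs = m}"
    by blast
qed

lemma finite_Bset: "finite (Bset m)"
  by (rule finite_subset[OF Bset_subset_image]) (simp add: finite_lists_length_eq)

lemma zeroB_in: "zeroB \<in> Bset m"
  by (simp add: zeroB_def Bset_def)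

section \<open>Ascending and descending runs of positions\<close>

fun run :: "(letter \<Rightarrow> letter) \<Rightarrow> letter \<Rightarrow> nat \<Rightarrow> letter list" where
  "run f p 0 = []"
| "run f p (Suc n) = p # run f (f p) n"

lemma length_run [simp]: "length (run f p n) = n"
  by (induction n arbitrary: p) auto

text \<open>Since \<open>rot\<close> has order 3, \<open>rot \<circ> rot\<close> is its inverse, so
  these are the ascending and the descending runs.\<close>

definition runs :: "nat \<Rightarrow> letter list set" where
  "runs n = (\<lambda>(f, p, j). run f p j) ` ({rot, rot \<circ> rot} \<times> UNIV \<times> {..n})"

lemma run_in_runs: "f \<in> {rot, rot \<circ> rot} \<Longrightarrow> j \<le> n \<Longrightarrow> run f p j \<in> runs n"
  unfolding runs_def by (rule image_eqI[of _ _ "(f, p, j)"]) auto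

lemma finite_runs: "finite (runs n)"
  by (auto simp: runs_def)

lemma card_runs: "card (runs n) \<le> 6 * (n + 1)"
proof -
  have "card (runs n) \<le> card ({rot, rot \<circ> rot} \<times> (UNIV :: letter set) \<times> {..n})"
    unfolding runs_def by (intro card_image_le) auto
  also have "\<dots> = card {rot, rot \<circ> rot} * (3 * (n + 1))"
    by (simp add: card_cartesian_product card_letters)
  also have "\<dots> \<le> 2 * (3 * (n + 1))"
    by (intro mult_right_mono) (auto simp: card_insert_if)
  finally show ?thesis by simp
qed

text \<open>A letter at \<open>p\<close> contributes a letter to the section at \<open>p\<close> and
  an exponent to the section at \<open>rot p\<close>. The condition excludes two exponents in one
  section with no letter between them.\<close>

fun good :: "letter list \<Rightarrow> bool" where
  "good [] = True"
| "good (p # ps) \<longleftrightarrow> p \<notin> set (takeWhile (\<lambda>y. y \<noteq> rot p) ps) \<and> good ps"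

text \<open>Three consecutive terms of a run are distinct, so \<open>rot p\<close> is met before
  \<open>p\<close> recurs.\<close>

lemma good_runs: "ps \<in> runs n \<Longrightarrow> good ps"
proof -
  have rot: "good (run rot p j)" for p j
  proof (induction j arbitrary: p)
    case (Suc j)
    then show ?case by (cases j) auto
  qed auto
  have rot2: "good (run (rot \<circ> rot) p j)" for p j
  proof (induction j arbitrary: p)
    case (Suc j)
    show ?case
    proof (cases j)
      case (Suc i)
      with Suc.IH[of "rot (rot p)"] show ?thesis by (cases i) auto
    qed auto
  qed auto
  show "ps \<in> runs n \<Longrightarrow> good ps"
    using rot rot2 by (auto simp: runs_def)
qed

lemma card_image_le_if_determined:
  assumes "finite (F ` M)" "\<And>w w'. w \<in> M \<Longrightarrow> w' \<in> M \<Longrightarrow> F w = F w' \<Longrightarrow> D w = D w'"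
  shows "card (D ` M) \<le> card (F ` M)"
proof -
  have "D w = D (inv_into M F (F w))" if "w \<in> M" for w
    using that by (intro assms(2)) (auto simp: inv_into_into f_inv_into_f)
  then have "D ` M = (\<lambda>y. D (inv_into M F y)) ` F ` M"
    by (force simp: image_image)
  then show ?thesis using card_image_le[OF assms(1)] by metis
qed

text \<open>Bernoulli's inequality bounds a linear function by a multiple of \<open>s ^ n\<close>
  for any s > 1. Take for \<open>s\<close> the root of order \<open>Suc e\<close> of
  \<open>q\<close>, which also makes sense for e = 0, and raise to the power
  \<open>e\<close>.\<close>

lemma poly_le_exp:
  fixes q a :: real
  assumes "q > 1" "a \<ge> 0"
  shows "\<exists>K\<ge>1. \<forall>n. (a * (real n + 1)) ^ e \<le> K * q ^ n"
proof -
  define s where "s = root (Suc e) q"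
  have s: "s > 1" "s ^ Suc e = q"
    using assms by (auto simp: s_def simp del: power_Suc)
  define C where "C = max 1 (a * max 1 (1 / (s - 1)))"
  have lin: "a * (real n + 1) \<le> C * s ^ n" for n
  proof -
    define D where "D = max 1 (1 / (s - 1))"
    have D: "D \<ge> 1" "D * (s - 1) \<ge> 1"
      using s(1) by (auto simp: D_def max_def field_simps)
    have "real n + 1 \<le> D * (1 + real n * (s - 1))"
      using mult_left_mono[OF D(2), of "real n"] D(1) by (simp add: algebra_simps)
    also have "\<dots> \<le> D * s ^ n"
      using Bernoulli_inequality[of "s - 1" n] s(1) D(1) by (intro mult_left_mono) auto
    finally have "real n + 1 \<le> D * s ^ n" .
    then have "a * (real n + 1) \<le> (a * D) * s ^ n"
      using assms(2) by (simp add: mult_left_mono mult.assoc)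
    also have "\<dots> \<le> C * s ^ n"
      using s(1) by (intro mult_right_mono) (auto simp: C_def D_def)
    finally show ?thesis .
  qed
  have "(a * (real n + 1)) ^ e \<le> C ^ e * q ^ n" for n
  proof -
    have C: "C \<ge> 0" by (simp add: C_def)
    have "(a * (real n + 1)) ^ e \<le> (C * s ^ n) ^ e"
      using assms(2) by (intro power_mono lin) auto
    also have "\<dots> = C ^ e * (s ^ e) ^ n"
      by (simp add: power_mult_distrib mult.commute flip: power_mult)
    also have "\<dots> \<le> C ^ e * (s ^ Suc e) ^ n"
      using s(1) C by (intro mult_left_mono power_mono power_increasing) auto
    finally show ?thesis by (simp only: s(2))
  qed
  moreover have "C ^ e \<ge> 1" by (simp add: C_def one_le_power)
  ultimately show ?thesis by blast
qed

section \<open>Words in conjugates of B, for all shifts of the sequence at once\<close>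

locale spinal =
  fixes m :: nat and \<omega> :: "nat \<Rightarrow> (nat \<Rightarrow> nat) \<Rightarrow> nat"
  assumes epi: "\<And>i. is_epi m (\<omega> i)"
begin

lemma \<omega>_less: "b \<in> Bset m \<Longrightarrow> \<omega> i b < 3"
  using epi[of i] by (auto simp: is_epi_def)

lemma \<omega>_add: "b \<in> Bset m \<Longrightarrow> c \<in> Bset m \<Longrightarrow> \<omega> i (addB b c) = (\<omega> i b + \<omega> i c) mod 3"
  using epi[of i] by (auto simp: is_epi_def)

lemma beta_add:
  assumes "b \<in> Bset m" "c \<in> Bset m"
  shows "beta \<omega> k (addB b c) v = beta \<omega> k b (beta \<omega> k c v)"
proof (induction v arbitrary: k)
  case (Cons x v)
  then show ?case
    using assms by (cases x) (auto simp: \<omega>_add rooted_rooted rooted_mod)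
qed auto

text \<open>The conjugate of \<open>\<beta>\<^sub>\<omega>(b)\<close> by a power of \<open>a\<close> is recorded by the subtree \<open>p\<close> that carries
  the recursive section.\<close>
fun conjB :: "nat \<Rightarrow> letter \<Rightarrow> (nat \<Rightarrow> nat) \<Rightarrow> letter list \<Rightarrow> letter list" where
  "conjB k p b [] = []"
| "conjB k p b (x # v) = x # (if x = p then beta \<omega> (Suc k) b v
     else if x = rot p then rooted (\<omega> k b) v else v)"

lemma conjB_L3: "conjB k L3 b = beta \<omega> k b"
proof
  fix v show "conjB k L3 b v = beta \<omega> k b v"
  proof (cases v)
    case (Cons x u)
    then show ?thesis by (cases x) auto
  qed auto
qed

lemma conjB_add:
  assumes "b \<in> Bset m" "c \<in> Bset m"
  shows "conjB k p (addB b c) v = conjB k p b (conjB k p c v)"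
  using assms by (cases v) (auto simp: beta_add \<omega>_add rooted_rooted rooted_mod)

lemma rooted_conjB: "rooted e (conjB k p b v) = conjB k ((rot ^^ e) p) b (rooted e v)"
  by (cases v) (auto simp: inj_rot_pow rot_rot_pow)

definition words :: "(letter \<times> (nat \<Rightarrow> nat)) list set" where
  "words = lists (UNIV \<times> Bset m)"

lemma words_simps [simp]:
  "[] \<in> words" "(p, b) # w \<in> words \<longleftrightarrow> b \<in> Bset m \<and> w \<in> words"
  "u @ v \<in> words \<longleftrightarrow> u \<in> words \<and> v \<in> words"
  by (auto simp: words_def)

fun ev :: "nat \<Rightarrow> (letter \<times> (nat \<Rightarrow> nat)) list \<Rightarrow> letter list \<Rightarrow> letter list" where
  "ev k [] = id"
| "ev k ((p, b) # w) = conjB k p b \<circ> ev k w"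

lemma ev_append: "ev k (u @ w) = ev k u \<circ> ev k w"
  by (induction k u rule: ev.induct) auto

text \<open>Conjugation by a power of a only rotates positions, so rooted factors move to the right
  of a word at no cost in length.\<close>

lemma rooted_ev:
  "\<exists>w'. length w' = length w \<and> (w \<in> words \<longrightarrow> w' \<in> words) \<and> rooted e \<circ> ev k w = ev k w' \<circ> rooted e"
proof (induction w)
  case Nil
  then show ?case by auto
next
  case (Cons y w)
  obtain p b where y: "y = (p, b)" by fastforce
  obtain w' where w': "length w' = length w" "w \<in> words \<longrightarrow> w' \<in> words"
    "rooted e \<circ> ev k w = ev k w' \<circ> rooted e"
    using Cons by blast
  have "rooted e (ev k w v) = ev k w' (rooted e v)" for v
    using fun_cong[OF w'(3), of v] by simp
  then have "rooted e \<circ> ev k (y # w) = ev k (((rot ^^ e) p, b) # w') \<circ> rooted e"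
    by (auto simp: y fun_eq_iff rooted_conjB)
  then show ?case
    using w'(1,2) by (intro exI[of _ "((rot ^^ e) p, b) # w'"] conjI) (simp_all add: y del: ev.simps)
qed

section \<open>Sections of words\<close>

text \<open>The section at \<open>x\<close> is a product of \<open>beta\<close> factors and rooted
  factors. Moving the rooted ones to the right end, where they add up to \<open>rexp\<close>,
  conjugates the \<open>beta\<close> factors they pass; \<open>q\<close> is the position reached by
  the exponents collected so far. It starts at \<open>L3\<close>, the position of an unconjugated
  \<open>beta\<close>.\<close>

fun sect :: "nat \<Rightarrow> letter \<Rightarrow> letter \<Rightarrow> (letter \<times> (nat \<Rightarrow> nat)) list \<Rightarrow> (letter \<times> (nat \<Rightarrow> nat)) list" where
  "sect k x q [] = []"
| "sect k x q ((p, b) # w) = (if p = x then (q, b) # sect k x q w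
     else if rot p = x then sect k x ((rot ^^ \<omega> k b) q) w else sect k x q w)"

fun rexp :: "nat \<Rightarrow> letter \<Rightarrow> (letter \<times> (nat \<Rightarrow> nat)) list \<Rightarrow> nat" where
  "rexp k x [] = 0"
| "rexp k x ((p, b) # w) = (if rot p = x then \<omega> k b else 0) + rexp k x w"

text \<open>The exponent \<open>e\<close> stands for the rotations contributed by letters further to
  the left; the induction needs the claim for all of them.\<close>

lemma ev_sect_aux:
  "\<exists>u. ev k w (x # v) = x # u \<and>
     (\<forall>e. rooted e u = ev (Suc k) (sect k x ((rot ^^ e) L3) w) (rooted (e + rexp k x w) v))"
proof (induction w)
  case Nil
  then show ?case by auto
next
  case (Cons y w)
  obtain p b where y: "y = (p, b)" by fastforce
  obtain u where u: "ev k w (x # v) = x # u"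
    "\<And>e. rooted e u = ev (Suc k) (sect k x ((rot ^^ e) L3) w) (rooted (e + rexp k x w) v)"
    using Cons by blast
  have swap: "(rot ^^ \<omega> k b) ((rot ^^ e) L3) = (rot ^^ (e + \<omega> k b)) L3" for e
    by (simp add: add.commute[of e] funpow_add)
  consider "p = x" | "rot p = x" | "p \<noteq> x" "rot p \<noteq> x" by blast
  then show ?case
  proof cases
    case 1
    then show ?thesis
      using u by (auto simp: y rooted_conjB simp flip: conjB_L3)
  next
    case 2
    have "rooted e (rooted (\<omega> k b) u) =
        ev (Suc k) (sect k x ((rot ^^ \<omega> k b) ((rot ^^ e) L3)) w) (rooted (e + (\<omega> k b + rexp k x w)) v)" for e
      unfolding rooted_rooted by (simp only: u(2) swap add.assoc)
    moreover have "sect k x q (y # w) = sect k x ((rot ^^ \<omega> k b) q) w"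
      "rexp k x (y # w) = \<omega> k b + rexp k x w" "ev k (y # w) (x # v) = x # rooted (\<omega> k b) u" for q
      using 2 u(1) by (auto simp: y)
    ultimately show ?thesis
      by metis
  next
    case 3
    then show ?thesis
      using u by (auto simp: y)
  qed
qed

lemma ev_sect:
  "ev k w = on_subtrees (\<lambda>x. ev (Suc k) (sect k x L3 w) \<circ> rooted (rexp k x w))"
proof
  fix v
  have nil: "ev k w [] = []"
    by (induction k w rule: ev.induct) auto
  show "ev k w v = on_subtrees (\<lambda>x. ev (Suc k) (sect k x L3 w) \<circ> rooted (rexp k x w)) v"
  proof (cases v)
    case (Cons x v')
    obtain u where u: "ev k w (x # v') = x # u"
      "\<And>e. rooted e u = ev (Suc k) (sect k x ((rot ^^ e) L3) w) (rooted (e + rexp k x w) v')"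
      using ev_sect_aux by blast
    show ?thesis
      using u(1) u(2)[of 0] by (simp add: Cons)
  qed (simp add: nil)
qed

text \<open>Each letter enters exactly one section, the one at its own position.\<close>

lemma length_sect:
  "length (sect k L1 q1 w) + length (sect k L2 q2 w) + length (sect k L3 q3 w) = length w"
proof (induction w arbitrary: q1 q2 q3)
  case (Cons y w)
  obtain p b where "y = (p, b)" by fastforce
  then show ?case using Cons by (cases p) auto
qed auto

lemma length_sect_le: "length (sect k x q w) \<le> length w"
proof (induction k x q w rule: sect.induct)
  case (2 k x q p b w)
  then show ?case by auto
qed auto

lemma sect_words: "w \<in> words \<Longrightarrow> sect k x q w \<in> words"
  by (induction k x q w rule: sect.induct) auto

section \<open>Elements with short sections\<close>

text \<open>Elements whose sections at depth \<open>d\<close> have total \<open>B\<close>-length at most \<open>n\<close>, in the group of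
  the \<open>k\<close>-th shift of \<open>\<omega>\<close>.\<close>
fun lev_ball :: "nat \<Rightarrow> nat \<Rightarrow> nat \<Rightarrow> (letter list \<Rightarrow> letter list) set" where
  "lev_ball 0 k n = {ev k w \<circ> rooted s | w s. w \<in> words \<and> length w \<le> n}"
| "lev_ball (Suc d) k n = {on_subtrees f \<circ> rooted s | f s.
     \<exists>\<nu>. (\<forall>x. f x \<in> lev_ball d (Suc k) (\<nu> x)) \<and> \<nu> L1 + \<nu> L2 + \<nu> L3 \<le> n}"

lemma lev_ball_mono: "i \<le> j \<Longrightarrow> lev_ball d k i \<subseteq> lev_ball d k j"
  by (cases d) (fastforce intro: order_trans)+

lemma lev_ball_mult:
  "f \<in> lev_ball d k i \<Longrightarrow> g \<in> lev_ball d k j \<Longrightarrow> f \<circ> g \<in> lev_ball d k (i + j)"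
proof (induction d arbitrary: k i j f g)
  case 0
  then obtain u s v t where f: "f = ev k u \<circ> rooted s" "u \<in> words" "length u \<le> i"
    and g: "g = ev k v \<circ> rooted t" "v \<in> words" "length v \<le> j"
    by auto
  obtain v' where v': "length v' = length v" "v' \<in> words"
    "rooted s \<circ> ev k v = ev k v' \<circ> rooted s"
    using rooted_ev[of v s k] g(2) by blast
  have "f \<circ> g = ev k u \<circ> (rooted s \<circ> ev k v) \<circ> rooted t"
    by (simp add: f g comp_assoc)
  also have "\<dots> = ev k (u @ v') \<circ> rooted (s + t)"
    unfolding v'(3) by (auto simp: fun_eq_iff ev_append rooted_rooted)
  finally have "f \<circ> g = ev k (u @ v') \<circ> rooted (s + t)" .
  moreover have "u @ v' \<in> words" "length (u @ v') \<le> i + j"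
    using f g v' by auto
  ultimately show ?case
    unfolding lev_ball.simps mem_Collect_eq
    by (intro exI[of _ "u @ v'"] exI[of _ "s + t"] conjI)
next
  case (Suc d)
  from Suc.prems obtain F s \<nu> where f: "f = on_subtrees F \<circ> rooted s"
    "\<And>x. F x \<in> lev_ball d (Suc k) (\<nu> x)" "\<nu> L1 + \<nu> L2 + \<nu> L3 \<le> i"
    by auto
  from Suc.prems obtain G t \<nu>' where g: "g = on_subtrees G \<circ> rooted t"
    "\<And>x. G x \<in> lev_ball d (Suc k) (\<nu>' x)" "\<nu>' L1 + \<nu>' L2 + \<nu>' L3 \<le> j"
    by auto
  \<comment> \<open>\<open>r\<close> inverts \<open>rot ^^ s\<close>, as 2 * s + s is a multiple of
    3. Being a permutation of the letters, it preserves the total of \<open>\<nu>'\<close>.\<close>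
  define r where "r = (\<lambda>x. (rot ^^ (2 * s)) x)"
  have r: "r ((rot ^^ s) x) = x" for x
  proof -
    have "r ((rot ^^ s) x) = (rot ^^ (2 * s + s)) x"
      by (simp only: r_def funpow_add comp_apply)
    also have "2 * s + s = 3 * s" by simp
    finally show ?thesis by simp
  qed
  have "f \<circ> g = on_subtrees (\<lambda>x. F x \<circ> G (r x)) \<circ> rooted (s + t)"
  proof
    fix v
    have "rooted s (on_subtrees G u) = on_subtrees (\<lambda>x. G (r x)) (rooted s u)" for u
      by (cases u) (auto simp: r)
    moreover have "on_subtrees F (on_subtrees H u) = on_subtrees (\<lambda>x. F x \<circ> H x) u" for H u
      by (cases u) auto
    ultimately show "(f \<circ> g) v = (on_subtrees (\<lambda>x. F x \<circ> G (r x)) \<circ> rooted (s + t)) v"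
      by (simp add: f g rooted_rooted)
  qed
  moreover have "F x \<circ> G (r x) \<in> lev_ball d (Suc k) (\<nu> x + \<nu>' (r x))" for x
    by (rule Suc.IH[OF f(2) g(2)])
  moreover have "\<nu>' (r L1) + \<nu>' (r L2) + \<nu>' (r L3) = \<nu>' L1 + \<nu>' L2 + \<nu>' L3"
  proof -
    have "r x = (rot ^^ (2 * s mod 3)) x" for x
      by (simp add: r_def rot_pow_mod)
    moreover have "2 * s mod 3 \<in> {0, 1, 2}"
      by auto
    ultimately show ?thesis
      by (auto simp: numeral_2_eq_2)
  qed
  ultimately show ?case
    using f(3) g(3)
    unfolding lev_ball.simps mem_Collect_eq
    by (intro exI[of _ "\<lambda>x. F x \<circ> G (r x)"] exI[of _ "s + t"] conjI exI[of _ "\<lambda>x. \<nu> x + \<nu>' (r x)"])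
       simp_all
qed

text \<open>By \<open>length_sect\<close> the sections of a word have the same total length as the
  word, so a bound on the length passes down to every depth.\<close>

lemma lev_ball_0_subset: "lev_ball 0 k n \<subseteq> lev_ball d k n"
proof (induction d arbitrary: k n)
  case (Suc d)
  show ?case
  proof
    fix f assume "f \<in> lev_ball 0 k n"
    then obtain w s where f: "f = ev k w \<circ> rooted s" "w \<in> words" "length w \<le> n"
      by auto
    define F where "F = (\<lambda>x. ev (Suc k) (sect k x L3 w) \<circ> rooted (rexp k x w))"
    have "F x \<in> lev_ball 0 (Suc k) (length (sect k x L3 w))" for x
      using sect_words[OF f(2)] by (auto simp: F_def)
    then have "F x \<in> lev_ball d (Suc k) (length (sect k x L3 w))" for x
      using Suc by blast
    moreover have "f = on_subtrees F \<circ> rooted s"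
      unfolding f(1) F_def by (subst ev_sect) simp
    ultimately show "f \<in> lev_ball (Suc d) k n"
      using length_sect[of k L3 w L3 L3] f(3)
      by (auto intro!: exI[of _ F] exI[of _ s] exI[of _ "\<lambda>x. length (sect k x L3 w)"])
  qed
qed auto

lemma rooted_lev_ball: "rooted s \<in> lev_ball d k 0"
  by (rule subsetD[OF lev_ball_0_subset]) (auto intro!: exI[of _ "[]"] exI[of _ s])

lemma ev_lev_ball: "w \<in> words \<Longrightarrow> ev k w \<in> lev_ball d k (length w)"
  by (rule subsetD[OF lev_ball_0_subset]) (auto intro!: exI[of _ w] exI[of _ 0])

section \<open>Incompressible words\<close>

text \<open>\<open>ev k w\<close> always lies in \<open>lev_ball d k (length w)\<close>; no smaller
  bound may hold. Since \<open>lev_ball\<close> refers to elements, all words representing the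
  sections compete.\<close>

definition inc :: "nat \<Rightarrow> nat \<Rightarrow> (letter \<times> (nat \<Rightarrow> nat)) list \<Rightarrow> bool" where
  "inc d k w \<longleftrightarrow> w \<in> words \<and> (\<forall>j < length w. ev k w \<notin> lev_ball d k j)"

text \<open>By \<open>lev_ball_mult\<close>, a saving in a factor is a saving in the whole
  word.\<close>

lemma inc_factor:
  assumes "inc d k (u @ w @ v)"
  shows "inc d k w"
  unfolding inc_def
proof (intro conjI allI impI notI)
  show "w \<in> words" using assms by (auto simp: inc_def)
next
  fix j assume j: "j < length w" "ev k w \<in> lev_ball d k j"
  have "ev k (u @ w @ v) \<in> lev_ball d k (length u + (j + length v))"
    using assms j(2) unfolding ev_append
    by (intro lev_ball_mult ev_lev_ball) (auto simp: inc_def)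
  then show False
    using assms j(1) by (auto simp: inc_def)
qed

lemma inc_appendD: "inc d k (u @ v) \<Longrightarrow> inc d k u" "inc d k (u @ v) \<Longrightarrow> inc d k v"
  using inc_factor[of d k "[]" u v] inc_factor[of d k u v "[]"] by auto

text \<open>A saving in one section, with the other two left as they are, is a saving for the word
  one level deeper.\<close>

lemma inc_sect:
  assumes "inc (Suc d) k w"
  shows "inc d (Suc k) (sect k x L3 w)"
  unfolding inc_def
proof (intro conjI allI impI notI)
  have w: "w \<in> words" using assms by (auto simp: inc_def)
  then show "sect k x L3 w \<in> words" by (rule sect_words)
  fix j assume j: "j < length (sect k x L3 w)" "ev (Suc k) (sect k x L3 w) \<in> lev_ball d (Suc k) j"
  define \<nu> where "\<nu> = (\<lambda>y. if y = x then j else length (sect k y L3 w))"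
  have "ev (Suc k) (sect k y L3 w) \<circ> rooted (rexp k y w) \<in> lev_ball d (Suc k) (\<nu> y + 0)" for y
    using j(2) sect_words[OF w]
    by (intro lev_ball_mult rooted_lev_ball) (auto simp: \<nu>_def intro: ev_lev_ball)
  moreover have "\<nu> L1 + \<nu> L2 + \<nu> L3 < length w"
    using j(1) length_sect[of k L3 w L3 L3] by (cases x) (auto simp: \<nu>_def)
  moreover have "ev k w = on_subtrees (\<lambda>y. ev (Suc k) (sect k y L3 w) \<circ> rooted (rexp k y w)) \<circ> rooted 0"
    by (subst ev_sect) simp
  ultimately have "ev k w \<in> lev_ball (Suc d) k (\<nu> L1 + \<nu> L2 + \<nu> L3)"
    unfolding lev_ball.simps mem_Collect_eq
    by (intro exI[of _ "\<lambda>y. ev (Suc k) (sect k y L3 w) \<circ> rooted (rexp k y w)"] exI[of _ 0]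
          exI[of _ \<nu>] conjI) auto
  then show False
    using assms \<open>\<nu> L1 + \<nu> L2 + \<nu> L3 < length w\<close> by (auto simp: inc_def)
qed

text \<open>Two adjacent letters in the same position multiply to a single letter.\<close>

lemma inc_no_repeat: "\<not> inc d k ((p, b) # (p, c) # w)"
proof
  assume "inc d k ((p, b) # (p, c) # w)"
  then have *: "inc d k [(p, b), (p, c)]"
    using inc_appendD(1)[of d k "[(p, b), (p, c)]" w] by simp
  then have bc: "b \<in> Bset m" "c \<in> Bset m"
    by (auto simp: inc_def)
  then have "ev k [(p, b), (p, c)] = ev k [(p, addB b c)]"
    by (auto simp: fun_eq_iff conjB_add)
  then have "ev k [(p, b), (p, c)] \<in> lev_ball d k 1"
    using ev_lev_ball[of "[(p, addB b c)]" k d] bc by (simp add: addB_in)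
  then show False
    using * by (auto simp: inc_def)
qed

text \<open>The middle letter affects only the sections at \<open>rot p\<close> and
  \<open>rot (rot p)\<close>, so the outer letters become adjacent in the section at
  \<open>p\<close>, in the same position.\<close>

lemma inc_no_turn: "\<not> inc (Suc d) k ((p, b) # (rot p, c) # (p, b') # w)"
proof
  assume "inc (Suc d) k ((p, b) # (rot p, c) # (p, b') # w)"
  then have "inc d (Suc k) (sect k p L3 ((p, b) # (rot p, c) # (p, b') # w))"
    by (rule inc_sect)
  then show False
    by (simp add: inc_no_repeat)
qed

section \<open>Counting incompressible words\<close>

text \<open>After a step from \<open>p\<close> to \<open>rot p\<close>, the next position is neither
  \<open>rot p\<close>, by \<open>inc_no_repeat\<close>, nor \<open>p\<close>, by
  \<open>inc_no_turn\<close>. Hence the ascent never stops.\<close>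

lemma inc_ascending:
  "inc (Suc d) k ((p, b) # (rot p, c) # w) \<Longrightarrow> \<exists>n. map fst w = run rot (rot (rot p)) n"
proof (induction w arbitrary: p b c)
  case Nil
  show ?case by (rule exI[of _ 0]) simp
next
  case (Cons y w)
  obtain q e where y: "y = (q, e)" by fastforce
  have tl: "inc (Suc d) k ((rot p, c) # y # w)"
    using inc_appendD(2)[of "Suc d" k "[(p, b)]"] Cons.prems by simp
  then have "q \<noteq> rot p" using inc_no_repeat by (auto simp: y)
  moreover have "q \<noteq> p" using Cons.prems inc_no_turn by (auto simp: y)
  ultimately have q: "q = rot (rot p)" by (cases p; cases q) auto
  then obtain n where "map fst w = run rot (rot (rot (rot p))) n"
    using Cons.IH[of "rot p" c e] tl by (auto simp: y)
  then show ?case by (intro exI[of _ "Suc n"]) (simp add: y q)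
qed

text \<open>An ascending step followed by a descending one creates two adjacent letters in the same
  position of a section, so the ascending steps all come last.\<close>
lemma inc_shape:
  "inc (Suc d) k w \<Longrightarrow> \<exists>p i p' j. map fst w = run (rot \<circ> rot) p i @ run rot p' j"
proof (induction w)
  case Nil
  show ?case by (intro exI[of _ 0] exI) simp
next
  case (Cons y w)
  obtain p b where y: "y = (p, b)" by fastforce
  show ?case
  proof (cases w)
    case Nil
    then show ?thesis by (intro exI[of _ p] exI[of _ 0] exI[of _ 1]) (simp add: y)
  next
    case (Cons z w')
    obtain q c where z: "z = (q, c)" by fastforce
    have "q \<noteq> p" using Cons.prems inc_no_repeat by (auto simp: y z Cons)
    then consider "q = rot p" | "q = rot (rot p)" by (cases p; cases q) auto
    then show ?thesis
    proof cases
      case 1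
      then obtain n where "map fst w' = run rot (rot (rot p)) n"
        using inc_ascending[of d k p b c w'] Cons.prems by (auto simp: y z Cons)
      then show ?thesis
        by (intro exI[of _ p] exI[of _ 0] exI[of _ "Suc (Suc n)"]) (simp add: y z Cons 1)
    next
      case 2
      have "inc (Suc d) k w"
        using inc_appendD(2)[of "Suc d" k "[y]"] Cons.prems by simp
      then obtain p0 i p' j where *: "map fst w = run (rot \<circ> rot) p0 i @ run rot p' j"
        using Cons.IH by blast
      show ?thesis
      proof (cases i)
        case 0
        then show ?thesis
          using * by (intro exI[of _ p] exI[of _ 1] exI[of _ p'] exI[of _ j]) (simp add: y)
      next
        case (Suc i')
        then have "p0 = rot (rot p)" using * by (simp add: \<open>w = z # w'\<close> z 2)
        then show ?thesis
          using * by - (rule exI[of _ p], rule exI[of _ "Suc i"], rule exI[of _ p'], rule exI[of _ j], simp add: y comp_def)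
      qed
    qed
  qed
qed

text \<open>The trace of a word seen through \<open>d\<close> consecutive epimorphisms. Traces are
  what the sections determine; they determine the word once the kernels intersect trivially.\<close>

definition dat :: "nat \<Rightarrow> nat \<Rightarrow> (letter \<times> (nat \<Rightarrow> nat)) list \<Rightarrow> (letter \<times> nat list) list" where
  "dat d k = map (\<lambda>(p, b). (p, map (\<lambda>i. \<omega> i b) [k..<k + d]))"

lemma dat_simps [simp]:
  "dat d k [] = []" "dat d k ((p, b) # w) = (p, map (\<lambda>i. \<omega> i b) [k..<k + d]) # dat d k w"
  "dat d k (u @ w) = dat d k u @ dat d k w"
  by (auto simp: dat_def)

lemma fst_dat: "map fst (dat d k w) = map fst w"
  by (induction w) (auto simp: dat_def)

text \<open>No exponent enters the section at \<open>rot p\<close> before its first letter, so that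
  letter still sits at \<open>q\<close>. The appended final position covers a section without
  letters.\<close>

lemma sect_first:
  assumes "p \<notin> set (takeWhile (\<lambda>y. y \<noteq> rot p) (map fst w))"
  shows "hd (map fst (sect k (rot p) q w) @ [(rot ^^ rexp k (rot p) w) q]) = q"
  using assms
proof (induction w)
  case (Cons y w)
  obtain p' b where y: "y = (p', b)" by fastforce
  show ?case using Cons by (auto simp: y split: if_splits)
qed auto

text \<open>In a section of a good word, every increment of the exponent is separated from the next
  one by a letter, hence can be read off the sequence of positions.\<close>
lemma dat_eqI:
  assumes "map fst w = map fst w'" "good (map fst w)" "w \<in> words" "w' \<in> words"
    "\<And>x. dat d (Suc k) (sect k x (q x) w) = dat d (Suc k) (sect k x (q x) w')"
    "\<And>x. (rot ^^ rexp k x w) (q x) = (rot ^^ rexp k x w') (q x)"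
  shows "dat (Suc d) k w = dat (Suc d) k w'"
  using assms
proof (induction w arbitrary: w' q)
  case Nil
  then show ?case by simp
next
  case (Cons y w)
  obtain p b where y: "y = (p, b)" by fastforce
  obtain b' v where w': "w' = (p, b') # v"
    using Cons.prems(1) by (cases w') (auto simp: y)
  have bs: "b \<in> Bset m" "b' \<in> Bset m" "w \<in> words" "v \<in> words"
    using Cons.prems by (auto simp: y w')
  have fst: "map fst w = map fst v" using Cons.prems(1) by (simp add: w')
  have good: "p \<notin> set (takeWhile (\<lambda>y. y \<noteq> rot p) (map fst w))" "good (map fst w)"
    using Cons.prems(2) by (auto simp: y)
  let ?r = "(rot ^^ \<omega> k b) (q (rot p))" and ?r' = "(rot ^^ \<omega> k b') (q (rot p))"
  have sec: "dat d (Suc k) (sect k (rot p) ?r w) = dat d (Suc k) (sect k (rot p) ?r' v)"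
    using Cons.prems(5)[of "rot p"] by (simp add: y w')
  have fin: "(rot ^^ rexp k (rot p) w) ?r = (rot ^^ rexp k (rot p) v) ?r'"
    using Cons.prems(6)[of "rot p"]
    by (simp add: y w' add.commute[of "\<omega> k b"] add.commute[of "\<omega> k b'"] funpow_add)
  have "map fst (sect k (rot p) ?r w) = map fst (sect k (rot p) ?r' v)"
    using arg_cong[OF sec, of "map fst"] by (simp add: fst_dat)
  \<comment> \<open>By \<open>sect_first\<close>, both starting positions are the heads of lists
    that agree for the two words.\<close>
  then have r: "?r = ?r'"
    using sect_first[of p w k ?r] sect_first[of p v k ?r'] good(1) fin by (simp add: fst)
  then have \<omega>: "\<omega> k b = \<omega> k b'"
    using bs by (intro rot_pow_eqD[OF r] \<omega>_less)
  have "dat (Suc d) k w = dat (Suc d) k v"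
  \<comment> \<open>Removing the first letter changes the starting position of one section only,
    which is why \<open>q\<close> depends on the section.\<close>
  proof (rule Cons.IH[OF fst good(2) bs(3,4), of "q(rot p := ?r)"])
    fix x
    show "dat d (Suc k) (sect k x ((q(rot p := ?r)) x) w) = dat d (Suc k) (sect k x ((q(rot p := ?r)) x) v)"
      using Cons.prems(5)[of x] sec r by (auto simp: y w' split: if_splits)
    show "(rot ^^ rexp k x w) ((q(rot p := ?r)) x) = (rot ^^ rexp k x v) ((q(rot p := ?r)) x)"
      using Cons.prems(6)[of x] fin r by (auto simp: y w' split: if_splits)
  qed
  \<comment> \<open>The values from \<open>Suc k\<close> on are carried by the first letter of the
    section at \<open>p\<close>.\<close>
  moreover have "map (\<lambda>i. \<omega> i b) [Suc k..<Suc k + d] = map (\<lambda>i. \<omega> i b') [Suc k..<Suc k + d]"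
    using Cons.prems(5)[of p] by (simp add: y w')
  ultimately show ?case
    using \<omega> by (simp add: y w' upt_conv_Cons del: upt_Suc)
qed

section \<open>Counting traces by induction on the depth\<close>

definition inc_words :: "nat \<Rightarrow> nat \<Rightarrow> nat \<Rightarrow> (letter \<times> (nat \<Rightarrow> nat)) list set" where
  "inc_words d k n = {w. inc d k w \<and> length w \<le> n}"

definition inc_runs :: "nat \<Rightarrow> nat \<Rightarrow> nat \<Rightarrow> (letter \<times> (nat \<Rightarrow> nat)) list set" where
  "inc_runs d k n = {w \<in> inc_words d k n. map fst w \<in> runs n}"

lemma finite_inc_words: "finite (inc_words d k n)"
  by (rule finite_subset[OF _ finite_lists_length_le[of "UNIV \<times> Bset m" n]])
     (auto simp: inc_words_def inc_def words_def finite_Bset)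

lemma finite_inc_runs: "finite (inc_runs d k n)"
  using finite_inc_words by (simp add: inc_runs_def)

lemma inc_words_split:
  assumes "w \<in> inc_words (Suc d) k n"
  obtains u v where "w = u @ v" "u \<in> inc_runs (Suc d) k n" "v \<in> inc_runs (Suc d) k n"
proof -
  have w: "inc (Suc d) k w" "length w \<le> n"
    using assms by (auto simp: inc_words_def)
  obtain p i p' j where *: "map fst w = run (rot \<circ> rot) p i @ run rot p' j"
    using inc_shape[OF w(1)] by blast
  define u v where "u = take i w" and "v = drop i w"
  have uv: "w = u @ v" by (simp add: u_def v_def)
  have "length w = i + j"
    using arg_cong[OF *, of length] by simp
  then have "map fst u = run (rot \<circ> rot) p i" "map fst v = run rot p' j" "i \<le> n" "j \<le> n"
    using * w(2) by (auto simp: u_def v_def take_map[symmetric] drop_map[symmetric])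
  then have "map fst u \<in> runs n" "map fst v \<in> runs n"
    by (auto intro: run_in_runs)
  then show ?thesis
    using that[OF uv] w inc_appendD[of "Suc d" k u v]
    by (auto simp: inc_runs_def inc_words_def uv)
qed

text \<open>Cut each word at its turning point into two runs; traces respect concatenation.\<close>

lemma card_dat_words_le:
  "card (dat d k ` inc_words (Suc d) k n) \<le> card (dat d k ` inc_runs (Suc d) k n) ^ 2"
proof -
  let ?R = "dat d k ` inc_runs (Suc d) k n"
  have "dat d k ` inc_words (Suc d) k n \<subseteq> (\<lambda>(u, v). u @ v) ` (?R \<times> ?R)"
  proof
    fix y assume "y \<in> dat d k ` inc_words (Suc d) k n"
    then obtain w where "y = dat d k w" "w \<in> inc_words (Suc d) k n" by blast
    then obtain u v where "y = dat d k u @ dat d k v" "u \<in> inc_runs (Suc d) k n" "v \<in> inc_runs (Suc d) k n"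
      using inc_words_split by (metis dat_simps(3))
    then show "y \<in> (\<lambda>(u, v). u @ v) ` (?R \<times> ?R)" by force
  qed
  then have "card (dat d k ` inc_words (Suc d) k n) \<le> card ((\<lambda>(u, v). u @ v) ` (?R \<times> ?R))"
    by (intro card_mono) (auto simp: finite_inc_runs)
  also have "\<dots> \<le> card (?R \<times> ?R)"
    by (intro card_image_le) (auto simp: finite_inc_runs)
  finally show ?thesis by (simp add: card_cartesian_product power2_eq_square)
qed

lemma card_dat_runs_0: "card (dat 0 k ` inc_runs (Suc 0) k n) \<le> 6 * (n + 1)"
proof -
  have "dat 0 k w = map (\<lambda>p. (p, [])) (map fst w)" for w
    by (auto simp: dat_def)
  then have "dat 0 k ` inc_runs (Suc 0) k n \<subseteq> map (\<lambda>p. (p, [])) ` runs n"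
    by (auto simp: inc_runs_def simp del: map_map)
  then have "card (dat 0 k ` inc_runs (Suc 0) k n) \<le> card (map (\<lambda>p. (p, [])) ` runs n :: (letter \<times> nat list) list set)"
    by (intro card_mono) (auto simp: finite_runs)
  also have "\<dots> \<le> card (runs n)"
    by (intro card_image_le finite_runs)
  finally show ?thesis using card_runs[of n] by simp
qed

text \<open>By \<open>dat_eqI\<close>, the trace is determined by the positions together with the
  trace and the final position of each section. With at most 6 * (n + 1) runs and 3 final positions
  per section, the constant is 162 = 6 * 3 ^ 3.\<close>

lemma card_dat_runs_Suc:
  "card (dat (Suc d) k ` inc_runs (Suc (Suc d)) k n)
     \<le> 162 * (n + 1) * card (dat d (Suc k) ` inc_words (Suc d) (Suc k) n) ^ 3"
proof -
  let ?M = "inc_runs (Suc (Suc d)) k n"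
  let ?N = "dat d (Suc k) ` inc_words (Suc d) (Suc k) n"
  define G where "G = (\<lambda>x w. (dat d (Suc k) (sect k x L3 w), (rot ^^ rexp k x w) L3))"
  define F where "F = (\<lambda>w. (map fst w, G L1 w, G L2 w, G L3 w))"
  let ?T = "runs n \<times> (?N \<times> (UNIV :: letter set)) \<times> (?N \<times> (UNIV :: letter set)) \<times>
    (?N \<times> (UNIV :: letter set))"
  have fin: "finite ?T"
    by (intro finite_cartesian_product finite_runs finite_imageI finite_inc_words finite_letters)
  have G: "G x w \<in> ?N \<times> (UNIV :: letter set)" if "w \<in> ?M" for x w
    using that inc_sect[of "Suc d" k w x] length_sect_le[of k x L3 w]
    by (auto simp: G_def inc_runs_def inc_words_def intro!: imageI)
  then have sub: "F ` ?M \<subseteq> ?T"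
    unfolding F_def image_subset_iff by (intro ballI SigmaI G) (auto simp: inc_runs_def)
  have "card (dat (Suc d) k ` ?M) \<le> card (F ` ?M)"
  proof (rule card_image_le_if_determined)
    show "finite (F ` ?M)" using finite_inc_runs by simp
    fix w w' assume w: "w \<in> ?M" "w' \<in> ?M" "F w = F w'"
    then have "G x w = G x w'" for x
      by (cases x) (auto simp: F_def)
    then show "dat (Suc d) k w = dat (Suc d) k w'"
      using w good_runs
      by (intro dat_eqI[where q = "\<lambda>_. L3"]) (auto simp: F_def G_def inc_runs_def inc_words_def inc_def)
  qed
  also have "\<dots> \<le> card ?T"
    by (rule card_mono[OF fin sub])
  also have "\<dots> = card (runs n) * (card ?N * 3) ^ 3"
    by (simp add: card_cartesian_product card_letters power3_eq_cube)
  also have "\<dots> \<le> 6 * (n + 1) * (card ?N * 3) ^ 3"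
    by (intro mult_right_mono card_runs) auto
  finally show ?thesis by (simp add: power_mult_distrib algebra_simps)
qed

text \<open>Solves the recursion (X * (X ^ e) ^ 3) ^ 2 = X ^ (6 * e + 2): the cube comes from the
  three sections, the square from the two runs.\<close>

fun expo :: "nat \<Rightarrow> nat" where
  "expo 0 = 2"
| "expo (Suc d) = 6 * expo d + 2"

lemma card_dat_words: "card (dat d k ` inc_words (Suc d) k n) \<le> (162 * (n + 1)) ^ expo d"
proof (induction d arbitrary: k)
  case 0
  have "card (dat 0 k ` inc_words (Suc 0) k n) \<le> (6 * (n + 1)) ^ 2"
    using card_dat_words_le[of 0 k n] power_mono[OF card_dat_runs_0[of k n], of 2] by linarith
  also have "\<dots> \<le> (162 * (n + 1)) ^ 2"
    by (intro power_mono) auto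
  finally show ?case by simp
next
  case (Suc d)
  let ?X = "162 * (n + 1)"
  have "card (dat (Suc d) k ` inc_runs (Suc (Suc d)) k n) \<le> ?X * (?X ^ expo d) ^ 3"
    using card_dat_runs_Suc[of d k n] mult_left_mono[OF power_mono[OF Suc[of "Suc k"], of 3], of ?X]
    by linarith
  then have "card (dat (Suc d) k ` inc_runs (Suc (Suc d)) k n) ^ 2 \<le> (?X * (?X ^ expo d) ^ 3) ^ 2"
    by (intro power_mono) auto
  also have "\<dots> = ?X ^ expo (Suc d)"
    by (simp add: power_mult_distrib power2_eq_square flip: power_mult power_add)
  finally show ?case
    using card_dat_words_le[of "Suc d" k n] by linarith
qed

text \<open>When the kernels in the window intersect trivially, the \<open>l + 1\<close> values
  determine each letter, so \<open>dat (Suc l)\<close> is injective and the count of traces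
  applies.\<close>

lemma card_inc_words:
  assumes "(\<Inter>i\<in>{k..k+l}. kerB m (\<omega> i)) = {zeroB}"
  shows "card (inc_words (l + 2) k n) \<le> (162 * (n + 1)) ^ expo (Suc l)"
proof -
  have inj: "b = c" if bc: "b \<in> Bset m" "c \<in> Bset m" and eq: "\<And>i. i \<in> {k..k+l} \<Longrightarrow> \<omega> i b = \<omega> i c" for b c
  proof -
    \<comment> \<open>In exponent 3 this is the difference of \<open>b\<close> and
      \<open>c\<close>.\<close>
    let ?z = "addB b (addB c c)"
    have "?z \<in> kerB m (\<omega> i)" if "i \<in> {k..k+l}" for i
    proof -
      have "\<omega> i ?z = (\<omega> i c + (\<omega> i c + \<omega> i c) mod 3) mod 3"
        using bc eq[OF that] by (simp add: \<omega>_add addB_in)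
      also have "\<dots> = (3 * \<omega> i c) mod 3" by presburger
      finally show ?thesis using bc by (simp add: kerB_def addB_in)
    qed
    then have "?z = zeroB" using assms by blast
    then have z: "(b j + (c j + c j) mod 3) mod 3 = 0" for j
      by (auto simp: addB_def zeroB_def dest: fun_cong[of _ _ j])
    show "b = c"
    proof
      fix j
      have "b j < 3" "c j < 3"
        using bc by (cases "j < m"; auto simp: Bset_def)+
      then show "b j = c j" using z[of j] by presburger
    qed
  qed
  have "inj_on (dat (Suc l) k) (inc_words (l + 2) k n)"
  proof (rule inj_onI)
    fix w w' assume "w \<in> inc_words (l + 2) k n" "w' \<in> inc_words (l + 2) k n"
      and eq: "dat (Suc l) k w = dat (Suc l) k w'"
    then have "w \<in> words" "w' \<in> words" by (auto simp: inc_words_def inc_def)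
    then show "w = w'"
      using eq
    proof (induction w arbitrary: w')
      case Nil
      then show ?case by (cases w') auto
    next
      case (Cons y w)
      obtain p b where y: "y = (p, b)" by fastforce
      obtain c v where w': "w' = (p, c) # v"
        using Cons.prems(3) by (cases w') (auto simp: y)
      have "map (\<lambda>i. \<omega> i b) [k..<k + Suc l] = map (\<lambda>i. \<omega> i c) [k..<k + Suc l]"
        using Cons.prems(3) by (simp add: y w' del: upt_Suc)
      then have "\<omega> i b = \<omega> i c" if "i \<in> {k..k+l}" for i
        using that by (simp add: map_eq_conv del: upt_Suc)
      then have "b = c" using Cons.prems by (intro inj) (auto simp: y w')
      then show ?case using Cons by (auto simp: y w')
    qed
  qed
  then have "card (inc_words (l + 2) k n) = card (dat (Suc l) k ` inc_words (l + 2) k n)"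
    by (simp add: card_image)
  then show ?thesis using card_dat_words[of "Suc l" k n] by simp
qed

section \<open>Factorization into incompressible words\<close>

text \<open>A link is a letter that destroys incompressibility, followed by the incompressible word
  in front of which it was put. The saving per link is recorded in
  \<open>factorization\<close>.\<close>

fun chains :: "nat \<Rightarrow> nat \<Rightarrow> nat \<Rightarrow> (letter \<times> (nat \<Rightarrow> nat)) list set" where
  "chains d k 0 = {[]}"
| "chains d k (Suc p) = {y # u @ v | y u v. y \<in> UNIV \<times> Bset m \<and> inc d k u \<and> v \<in> chains d k p}"

lemma inc_Nil [simp]: "inc d k []"
  by (simp add: inc_def)

text \<open>Letters are added on the left of the incompressible word \<open>u\<close>. As soon as
  \<open>y # u\<close> is compressible it saves at least 1, is moved to the chain as a new link, and
  \<open>u\<close> restarts empty.\<close>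

lemma factorization:
  "w \<in> words \<Longrightarrow> \<exists>p u v j. w = u @ v \<and> inc d k u \<and> v \<in> chains d k p \<and>
     ev k v \<in> lev_ball d k j \<and> j + p \<le> length v"
proof (induction w)
  case Nil
  have "ev k [] \<in> lev_ball d k 0"
    using ev_lev_ball[of "[]" k d] by simp
  then show ?case
    by - (rule exI[of _ 0], rule exI[of _ "[]"], rule exI[of _ "[]"], rule exI[of _ 0], simp add: id_def)
next
  case (Cons y w)
  obtain a b where y: "y = (a, b)" by fastforce
  obtain p u v j where *: "w = u @ v" "inc d k u" "v \<in> chains d k p"
    "ev k v \<in> lev_ball d k j" "j + p \<le> length v"
    using Cons by (auto simp: y)
  show ?case
  proof (cases "inc d k (y # u)")
    case True
    then show ?thesis
      using * by - (rule exI[of _ p], rule exI[of _ "y # u"], rule exI[of _ v], rule exI[of _ j], simp)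
  next
    case False
    then obtain i where i: "i < length (y # u)" "ev k (y # u) \<in> lev_ball d k i"
      using Cons.prems * by (auto simp: inc_def y)
    have "ev k ((y # u) @ v) \<in> lev_ball d k (i + j)"
      unfolding ev_append by (intro lev_ball_mult i *)
    moreover have "y # u @ v \<in> chains d k (Suc p)"
      using * Cons.prems by (auto simp: y)
    ultimately show ?thesis
      using i(1) *
      by - (rule exI[of _ "Suc p"], rule exI[of _ "[]"], rule exI[of _ "y # u @ v"],
          rule exI[of _ "i + j"], simp)
  qed
qed

definition nlet :: nat where
  "nlet = card ((UNIV :: letter set) \<times> Bset m)"

lemma nlet_pos: "nlet > 0"
  using zeroB_in[of m] by (auto simp: nlet_def card_gt_0_iff finite_Bset)

text \<open>Incompressible words are counted with base \<open>q\<close> but chains with base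
  \<open>q\<^sup>2\<close>. A first link with incompressible part of length \<open>i\<close> thus
  gains a factor (1 / q) ^ i, and the geometric series over \<open>i\<close> leaves a constant
  factor per link.\<close>

lemma card_chains:
  fixes K q :: real
  assumes q: "q > 1" and inc: "\<And>n. real (card (inc_words d k n)) \<le> K * q ^ n"
  shows "finite {w \<in> chains d k p. length w \<le> n} \<and>
    real (card {w \<in> chains d k p. length w \<le> n}) \<le> (nlet * K * (q / (q - 1))) ^ p * (q\<^sup>2) ^ n"
proof (induction p arbitrary: n)
  case 0
  have "{w \<in> chains d k 0. length w \<le> n} = {[]}" by auto
  then show ?case using q by (simp add: one_le_power)
next
  case (Suc p)
  have K: "K \<ge> 0" using inc[of 0] by (simp add: order_trans[OF of_nat_0_le_iff])
  let ?M = "nlet * K * (q / (q - 1))"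
  let ?B = "\<lambda>i. ((UNIV :: letter set) \<times> Bset m) \<times> inc_words d k i \<times> {v \<in> chains d k p. length v \<le> n - i}"
  let ?A = "\<lambda>i. (\<lambda>(y, u, v). y # u @ v) ` ?B i"
  have fin: "finite (?B i)" for i
    using Suc.IH[of "n - i"] by (intro finite_cartesian_product) (auto simp: finite_Bset finite_inc_words)
  have sub: "{w \<in> chains d k (Suc p). length w \<le> n} \<subseteq> (\<Union>i\<le>n. ?A i)"
  proof
    fix w assume "w \<in> {w \<in> chains d k (Suc p). length w \<le> n}"
    then obtain y u v where w: "w = y # u @ v" "y \<in> UNIV \<times> Bset m" "inc d k u" "v \<in> chains d k p"
      "length (y # u @ v) \<le> n" by auto
    then have "w \<in> ?A (length u)"
      by (intro image_eqI[of _ _ "(y, u, v)"]) (auto simp: inc_words_def)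
    moreover have "length u \<le> n" using w by simp
    ultimately show "w \<in> (\<Union>i\<le>n. ?A i)" by blast
  qed
  have "real (card {w \<in> chains d k (Suc p). length w \<le> n}) \<le> real (card (\<Union>i\<le>n. ?A i))"
    using fin by (intro of_nat_mono card_mono[OF _ sub]) auto
  also have "\<dots> \<le> (\<Sum>i\<le>n. real (card (?A i)))"
    using card_UN_le[of "{..n}" ?A] by (simp flip: of_nat_sum)
  also have "\<dots> \<le> (\<Sum>i\<le>n. (nlet * K * ?M ^ p * (q\<^sup>2) ^ n) * (1 / q) ^ i)"
  proof (rule sum_mono)
    fix i assume i: "i \<in> {..n}"
    have "real (card (?A i)) \<le> real (card (?B i))"
      by (intro of_nat_mono card_image_le fin)
    also have "\<dots> = nlet * (real (card (inc_words d k i)) *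
        real (card {v \<in> chains d k p. length v \<le> n - i}))"
      by (simp add: card_cartesian_product nlet_def)
    also have "\<dots> \<le> nlet * ((K * q ^ i) * (?M ^ p * (q\<^sup>2) ^ (n - i)))"
      using Suc.IH[of "n - i"] inc[of i] q K by (intro mult_left_mono mult_mono) auto
    also have "(q\<^sup>2) ^ (n - i) = (q\<^sup>2) ^ n / (q\<^sup>2) ^ i"
      using i q by (simp add: power_diff)
    also have "nlet * ((K * q ^ i) * (?M ^ p * ((q\<^sup>2) ^ n / (q\<^sup>2) ^ i)))
        = (nlet * K * ?M ^ p * (q\<^sup>2) ^ n) * (1 / q) ^ i"
      using q by (simp add: field_simps power2_eq_square power_mult_distrib)
    finally show "real (card (?A i)) \<le> (nlet * K * ?M ^ p * (q\<^sup>2) ^ n) * (1 / q) ^ i" .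
  qed
  also have "\<dots> = (nlet * K * ?M ^ p * (q\<^sup>2) ^ n) * (\<Sum>i\<le>n. (1 / q) ^ i)"
    by (simp add: sum_distrib_left)
  also have "\<dots> \<le> (nlet * K * ?M ^ p * (q\<^sup>2) ^ n) * (q / (q - 1))"
  proof (rule mult_left_mono)
    have "(\<Sum>i\<le>n. (1 / q) ^ i) = (1 - (1 / q) ^ Suc n) / (1 - 1 / q)"
      using q by (simp add: sum_gp0)
    also have "\<dots> \<le> 1 / (1 - 1 / q)"
      using q by (intro divide_right_mono) auto
    also have "\<dots> = q / (q - 1)"
      using q by (simp add: field_simps)
    finally show "(\<Sum>i\<le>n. (1 / q) ^ i) \<le> q / (q - 1)" .
  qed (use q K in auto)
  also have "\<dots> = ?M ^ Suc p * (q\<^sup>2) ^ n"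
    by simp
  finally have "real (card {w \<in> chains d k (Suc p). length w \<le> n}) \<le> ?M ^ Suc p * (q\<^sup>2) ^ n" .
  moreover have "finite {w \<in> chains d k (Suc p). length w \<le> n}"
    by (rule finite_subset[OF sub]) (intro finite_UN_I finite_imageI fin finite_atMost)
  ultimately show ?case by (rule conjI[rotated])
qed

section \<open>Growth rates\<close>

lemma lev_ball_0_image:
  "lev_ball 0 k n \<subseteq> (\<lambda>(w, s). ev k w \<circ> rooted s) ` ({w \<in> words. length w \<le> n} \<times> {..<3})"
proof
  fix f assume "f \<in> lev_ball 0 k n"
  then obtain w s where "f = ev k w \<circ> rooted s" "w \<in> words" "length w \<le> n" by auto
  then show "f \<in> (\<lambda>(w, s). ev k w \<circ> rooted s) ` ({w \<in> words. length w \<le> n} \<times> {..<3})"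
    by (intro image_eqI[of _ _ "(w, s mod 3)"]) (auto simp: rooted_mod)
qed

lemma finite_words_le: "finite {w \<in> words. length w \<le> n}"
  by (rule finite_subset[OF _ finite_lists_length_le[of "UNIV \<times> Bset m" n]])
     (auto simp: words_def finite_Bset)

lemma card_words_le: "card {w \<in> words. length w \<le> n} \<le> (nlet + 1) ^ n"
proof -
  have "{w \<in> words. length w \<le> n} = {w. set w \<subseteq> UNIV \<times> Bset m \<and> length w \<le> n}"
    by (auto simp: words_def)
  then have "card {w \<in> words. length w \<le> n} = (\<Sum>i\<le>n. nlet ^ i)"
    using card_lists_length_le[of "(UNIV :: letter set) \<times> Bset m" n] finite_Bset
    by (simp only: nlet_def finite_cartesian_product finite_letters)
  also have "\<dots> \<le> (nlet + 1) ^ n"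
  proof (induction n)
    case (Suc n)
    have "nlet * nlet ^ n \<le> nlet * (nlet + 1) ^ n"
      by (intro mult_left_mono power_mono) auto
    then show ?case
      using Suc by (simp only: sum.atMost_Suc power_Suc distrib_right)
  qed simp
  finally show ?thesis .
qed

lemma card_lev_ball_0: "card (lev_ball 0 k n) \<le> 3 * (nlet + 1) ^ n"
proof -
  have "card (lev_ball 0 k n) \<le> card ({w \<in> words. length w \<le> n} \<times> {..<3::nat})"
    by (rule order_trans[OF card_mono[OF _ lev_ball_0_image] card_image_le])
       (auto simp: finite_words_le)
  then show ?thesis
    using card_words_le[of n] by (simp add: card_cartesian_product)
qed

definition assemble ::
  "(letter list \<Rightarrow> letter list) \<times> (letter list \<Rightarrow> letter list) \<times> (letter list \<Rightarrow> letter list) \<times> nat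
     \<Rightarrow> letter list \<Rightarrow> letter list" where
  "assemble = (\<lambda>(f, g, h, s). on_subtrees (case_letter f g h) \<circ> rooted s)"

lemma lev_ball_Suc_image:
  "lev_ball (Suc d) k n \<subseteq> (\<Union>i\<le>n. \<Union>j\<le>n - i. assemble `
     (lev_ball d (Suc k) i \<times> lev_ball d (Suc k) j \<times> lev_ball d (Suc k) (n - i - j) \<times> {..<3}))"
proof
  fix f assume "f \<in> lev_ball (Suc d) k n"
  then obtain F s \<nu> where f: "f = on_subtrees F \<circ> rooted s"
    "\<And>x. F x \<in> lev_ball d (Suc k) (\<nu> x)" "\<nu> L1 + \<nu> L2 + \<nu> L3 \<le> n"
    by auto
  have "F = case_letter (F L1) (F L2) (F L3)"
    by (auto simp: fun_eq_iff split: letter.splits)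
  then have "f = assemble (F L1, F L2, F L3, s mod 3)"
    using f(1) by (simp add: assemble_def rooted_mod)
  moreover have "F L3 \<in> lev_ball d (Suc k) (n - \<nu> L1 - \<nu> L2)"
    using f(2)[of L3] f(3) subsetD[OF lev_ball_mono[of "\<nu> L3" "n - \<nu> L1 - \<nu> L2" d "Suc k"]] by auto
  ultimately have "f \<in> assemble ` (lev_ball d (Suc k) (\<nu> L1) \<times> lev_ball d (Suc k) (\<nu> L2) \<times>
      lev_ball d (Suc k) (n - \<nu> L1 - \<nu> L2) \<times> {..<3})"
    using f(2)[of L1] f(2)[of L2] by (intro image_eqI) auto
  moreover have "\<nu> L1 \<in> {..n}" "\<nu> L2 \<in> {..n - \<nu> L1}"
    using f(3) by auto
  ultimately show "f \<in> (\<Union>i\<le>n. \<Union>j\<le>n - i. assemble `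
     (lev_ball d (Suc k) i \<times> lev_ball d (Suc k) j \<times> lev_ball d (Suc k) (n - i - j) \<times> {..<3}))"
    by blast
qed

lemma finite_lev_ball: "finite (lev_ball d k n)"
proof (induction d arbitrary: k n)
  case 0
  show ?case
    by (rule finite_subset[OF lev_ball_0_image]) (auto simp: finite_words_le)
next
  case (Suc d)
  then show ?case
    by (intro finite_subset[OF lev_ball_Suc_image] finite_UN_I finite_imageI finite_cartesian_product) auto
qed

text \<open>The length \<open>n\<close> is distributed over three sections in at most (n + 1) ^ 2
  ways; for each, the three bounds multiply to one power of \<open>\<mu>\<close>, and there are 3
  rooted factors.\<close>

lemma card_lev_ball_Suc:
  assumes "\<And>n. real (card (lev_ball d (Suc k) n)) \<le> K * \<mu> ^ n" "\<mu> > 0"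
  shows "real (card (lev_ball (Suc d) k n)) \<le> (real n + 1)\<^sup>2 * (3 * K ^ 3 * \<mu> ^ n)"
proof -
  have K: "K \<ge> 0" using assms(1)[of 0] by (simp add: order_trans[OF of_nat_0_le_iff])
  let ?B = "\<lambda>i j. lev_ball d (Suc k) i \<times> lev_ball d (Suc k) j \<times> lev_ball d (Suc k) (n - i - j) \<times> {..<3::nat}"
  have fin: "finite (?B i j)" for i j
    by (intro finite_cartesian_product finite_lev_ball) auto
  have B: "real (card (assemble ` ?B i j)) \<le> 3 * K ^ 3 * \<mu> ^ n" if "i \<le> n" "j \<le> n - i" for i j
  proof -
    have "real (card (assemble ` ?B i j)) \<le> real (card (?B i j))"
      by (intro of_nat_mono card_image_le fin)
    also have "\<dots> = real (card (lev_ball d (Suc k) i)) * (real (card (lev_ball d (Suc k) j)) *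
        (real (card (lev_ball d (Suc k) (n - i - j))) * 3))"
      by (simp add: card_cartesian_product)
    also have "\<dots> \<le> (K * \<mu> ^ i) * ((K * \<mu> ^ j) * ((K * \<mu> ^ (n - i - j)) * 3))"
      using assms K by (intro mult_mono mult_right_mono) auto
    also have "\<dots> = 3 * K ^ 3 * \<mu> ^ (i + j + (n - i - j))"
      by (simp add: power_add power3_eq_cube)
    finally show ?thesis using that by simp
  qed
  have "real (card (lev_ball (Suc d) k n)) \<le> real (card (\<Union>i\<le>n. \<Union>j\<le>n - i. assemble ` ?B i j))"
    using fin by (intro of_nat_mono card_mono[OF _ lev_ball_Suc_image] finite_UN_I finite_imageI) auto
  also have "\<dots> \<le> real (\<Sum>i\<le>n. \<Sum>j\<le>n - i. card (assemble ` ?B i j))"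
    by (intro of_nat_mono order_trans[OF card_UN_le] sum_mono card_UN_le) auto
  also have "\<dots> \<le> (\<Sum>i\<le>n. \<Sum>j\<le>n - i. 3 * K ^ 3 * \<mu> ^ n)"
    unfolding of_nat_sum by (intro sum_mono B) auto
  also have "\<dots> = (\<Sum>i\<le>n. (real (n - i) + 1) * (3 * K ^ 3 * \<mu> ^ n))"
    by (simp add: add.commute)
  also have "\<dots> \<le> (\<Sum>i\<le>n. (real n + 1) * (3 * K ^ 3 * \<mu> ^ n))"
    using K assms(2) by (intro sum_mono mult_right_mono) auto
  also have "\<dots> = (real n + 1)\<^sup>2 * (3 * K ^ 3 * \<mu> ^ n)"
    by (simp add: power2_eq_square algebra_simps)
  finally show ?thesis .
qed

text \<open>An upper bound for the exponential growth rate. Asking only for all \<mu> > r absorbs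
  polynomial factors and lets \<open>r\<close> be replaced by an infimum of bounds.\<close>

definition rate_le :: "nat \<Rightarrow> nat \<Rightarrow> real \<Rightarrow> bool" where
  "rate_le d k r \<longleftrightarrow> (\<forall>\<mu>>r. \<exists>K. \<forall>n. real (card (lev_ball d k n)) \<le> K * \<mu> ^ n)"

lemma rate_le_Suc:
  assumes "rate_le d (Suc k) r" "r \<ge> 1"
  shows "rate_le (Suc d) k r"
  unfolding rate_le_def
proof (intro allI impI)
  fix \<mu> assume \<mu>: "\<mu> > r"
  \<comment> \<open>The gap between \<open>\<nu>\<close> and \<open>\<mu>\<close> absorbs the
    quadratic factor of \<open>card_lev_ball_Suc\<close>.\<close>
  define \<nu> where "\<nu> = (r + \<mu>) / 2"
  have \<nu>: "r < \<nu>" "\<nu> < \<mu>" "\<nu> > 0" using \<mu> assms(2) by (auto simp: \<nu>_def)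
  obtain K where K: "\<And>n. real (card (lev_ball d (Suc k) n)) \<le> K * \<nu> ^ n"
    using assms(1) \<nu>(1) unfolding rate_le_def by blast
  have K0: "K \<ge> 0" using K[of 0] by (simp add: order_trans[OF of_nat_0_le_iff])
  have "\<mu> / \<nu> > 1" using \<nu> by simp
  then obtain C where C: "\<And>n. (1 * (real n + 1))\<^sup>2 \<le> C * (\<mu> / \<nu>) ^ n"
    using poly_le_exp[of "\<mu> / \<nu>" 1 2] by auto
  have "real (card (lev_ball (Suc d) k n)) \<le> (3 * K ^ 3 * C) * \<mu> ^ n" for n
  proof -
    have "real (card (lev_ball (Suc d) k n)) \<le> (real n + 1)\<^sup>2 * (3 * K ^ 3 * \<nu> ^ n)"
      by (rule card_lev_ball_Suc[OF K \<nu>(3)])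
    also have "\<dots> \<le> (C * (\<mu> / \<nu>) ^ n) * (3 * K ^ 3 * \<nu> ^ n)"
      using C[of n] K0 \<nu> by (intro mult_right_mono) auto
    also have "\<dots> = (3 * K ^ 3 * C) * \<mu> ^ n"
      using \<nu> by (simp add: power_divide)
    finally show ?thesis .
  qed
  then show "\<exists>K. \<forall>n. real (card (lev_ball (Suc d) k n)) \<le> K * \<mu> ^ n" by blast
qed

text \<open>Together with \<open>rate_le_0\<close>, this carries a rate bound from a later shift
  back to an earlier one.\<close>

lemma rate_le_shift:
  assumes "r \<ge> 1"
  shows "rate_le 0 (k + d) r \<Longrightarrow> rate_le d k r"
proof (induction d arbitrary: k)
  case (Suc d)
  then show ?case using Suc.IH[of "Suc k"] by (intro rate_le_Suc assms) simp
qed simp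

lemma rate_le_0:
  assumes "rate_le d k r"
  shows "rate_le 0 k r"
proof -
  have "real (card (lev_ball 0 k n)) \<le> real (card (lev_ball d k n))" for n
    by (intro of_nat_mono card_mono finite_lev_ball lev_ball_0_subset)
  then show ?thesis
    using assms unfolding rate_le_def by (meson order_trans)
qed

text \<open>The dummy first letter removed by \<open>tl\<close> turns the leading incompressible piece of a
  factorization into a link of the chain.\<close>
lemma lev_ball_0_split:
  "lev_ball 0 k n \<subseteq> lev_ball d k (n - Suc P) \<union>
     (\<Union>p\<le>P. (\<lambda>(w, s). ev k (tl w) \<circ> rooted s) `
        ({w \<in> chains d k (Suc p). length w \<le> Suc n} \<times> {..<3}))" (is "_ \<subseteq> ?A \<union> (\<Union>p\<le>P. ?B p)")
proof
  fix f assume "f \<in> lev_ball 0 k n"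
  then obtain w s where f: "f = ev k w \<circ> rooted s" "w \<in> words" "length w \<le> n" by auto
  obtain p u v j where w: "w = u @ v" "inc d k u" "v \<in> chains d k p"
    "ev k v \<in> lev_ball d k j" "j + p \<le> length v"
    using factorization[OF f(2)] by blast
  show "f \<in> ?A \<union> (\<Union>p\<le>P. ?B p)"
  proof (cases "p \<le> P")
    case True
    have "(L1, zeroB) # u @ v \<in> chains d k (Suc p)"
      using w zeroB_in by auto
    then have "f \<in> ?B p"
      using f w(1) by (intro image_eqI[of _ _ "((L1, zeroB) # u @ v, s mod 3)"]) (auto simp: rooted_mod)
    then show ?thesis using True by blast
  next
    \<comment> \<open>More than \<open>P\<close> links save at least \<open>Suc P\<close>.\<close>
    case False
    have "u \<in> words" using w(2) by (simp add: inc_def)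
    then have "ev k u \<circ> ev k v \<circ> rooted s \<in> lev_ball d k (length u + j + 0)"
      using w(4) by (intro lev_ball_mult ev_lev_ball rooted_lev_ball)
    moreover have "length u + j + 0 \<le> n - Suc P"
      using False f(3) w(1,5) by simp
    ultimately have "f \<in> ?A"
      unfolding f(1) w(1) ev_append by (rule subsetD[OF lev_ball_mono, rotated])
    then show ?thesis by (rule UnI1)
  qed
qed

text \<open>Take P = n div N. Elements with at most \<open>P\<close> links are few, since
  \<open>N\<close> is chosen to make (2 * M) ^ P at most (q ^ 2) ^ n. The others lose
  \<open>Suc P\<close> in length, roughly the fraction 1 / N, which replaces the rate
  \<open>\<mu>\<close> by \<open>r\<close>.\<close>

lemma contraction:
  fixes q K L M \<mu> r :: real
  defines "M \<equiv> nlet * K * (q / (q - 1))"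
  assumes q: "q > 1" and K: "K \<ge> 1"
    and inc: "\<And>n. real (card (inc_words d k n)) \<le> K * q ^ n"
    and lev: "\<And>n. real (card (lev_ball d k n)) \<le> L * \<mu> ^ n"
    and N: "N > 0" "2 * M \<le> (q\<^sup>2) ^ N"
    and \<mu>: "\<mu> \<ge> 1" "\<mu> ^ (N - 1) \<le> r ^ N" and r: "r \<ge> 1"
  shows "real (card (lev_ball 0 k n)) \<le> L * \<mu> ^ N * r ^ n + 6 * M * q\<^sup>2 * (q ^ 4) ^ n"
proof -
  define P where "P = n div N"
  have NP: "N * P \<le> n" by (simp add: P_def)
  have L: "L \<ge> 0" using lev[of 0] by (simp add: order_trans[OF of_nat_0_le_iff])
  have "1 * 1 * 1 \<le> nlet * K * (q / (q - 1))"
    using nlet_pos K q by (intro mult_mono) (auto simp: Suc_le_eq)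
  then have M: "M \<ge> 1" by (simp add: M_def)
  have q2: "q\<^sup>2 > 1" using q by (simp add: one_less_power)
  let ?C = "\<lambda>p. {w \<in> chains d k (Suc p). length w \<le> Suc n} \<times> {..<3::nat}"
  let ?B = "\<lambda>p. (\<lambda>(w, s). ev k (tl w) \<circ> rooted s) ` ?C p"
  have finC: "finite (?C p)" for p
    using card_chains[OF q inc] by (intro finite_cartesian_product) (auto simp del: chains.simps)
  have cardB: "real (card (?B p)) \<le> 3 * (M ^ Suc P * (q\<^sup>2) ^ Suc n)" if "p \<le> P" for p
  proof -
    have "real (card (?B p)) \<le> real (card (?C p))"
      by (intro of_nat_mono card_image_le finC)
    also have "\<dots> \<le> 3 * (M ^ Suc p * (q\<^sup>2) ^ Suc n)"
      using card_chains[OF q inc, of "Suc p" "Suc n"]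
      by (simp add: card_cartesian_product M_def del: chains.simps power_Suc)
    also have "\<dots> \<le> 3 * (M ^ Suc P * (q\<^sup>2) ^ Suc n)"
      using M that by (intro mult_left_mono mult_right_mono power_increasing) auto
    finally show ?thesis .
  qed
  have "real (card (lev_ball 0 k n)) \<le> real (card (lev_ball d k (n - Suc P) \<union> (\<Union>p\<le>P. ?B p)))"
    by (intro of_nat_mono card_mono[OF _ lev_ball_0_split] finite_UnI finite_lev_ball
         finite_UN_I finite_imageI finC finite_atMost)
  also have "\<dots> \<le> real (card (lev_ball d k (n - Suc P)) + card (\<Union>p\<le>P. ?B p))"
    by (intro of_nat_mono card_Un_le)
  also have "\<dots> \<le> real (card (lev_ball d k (n - Suc P))) + (\<Sum>p\<le>P. real (card (?B p)))"
    using card_UN_le[of "{..P}" ?B] by (simp flip: of_nat_sum)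
  also have "\<dots> \<le> L * \<mu> ^ (n - Suc P) + (\<Sum>p\<le>P. 3 * (M ^ Suc P * (q\<^sup>2) ^ Suc n))"
    using cardB by (intro add_mono lev sum_mono) auto
  also have "\<dots> = L * \<mu> ^ (n - Suc P) + 3 * (real (Suc P) * M ^ Suc P) * (q\<^sup>2) ^ Suc n"
    by simp
  also have "\<dots> \<le> L * (\<mu> ^ N * r ^ n) + 3 * (2 * M * (q\<^sup>2) ^ n) * (q\<^sup>2) ^ Suc n"
  proof (intro add_mono mult_left_mono mult_right_mono)
    \<comment> \<open>The remainder of \<open>n\<close> modulo \<open>N\<close> accounts for the
      extra \<open>N\<close>.\<close>
    have "n - Suc P \<le> (N - 1) * P + N"
    proof -
      obtain N' where N': "N = Suc N'" using N by (cases N) auto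
      define b where "b = n mod N"
      have "n = N * P + b" "b < N" using N by (auto simp: P_def b_def)
      then show ?thesis by (simp add: N')
    qed
    then have "\<mu> ^ (n - Suc P) \<le> \<mu> ^ ((N - 1) * P + N)"
      using \<mu>(1) by (intro power_increasing)
    also have "\<dots> = (\<mu> ^ (N - 1)) ^ P * \<mu> ^ N"
      by (simp add: power_add power_mult)
    also have "\<dots> \<le> (r ^ N) ^ P * \<mu> ^ N"
      using \<mu> by (intro mult_right_mono power_mono) auto
    also have "(r ^ N) ^ P * \<mu> ^ N \<le> r ^ n * \<mu> ^ N"
      using r \<mu>(1) NP by (intro mult_right_mono) (auto simp flip: power_mult intro: power_increasing)
    finally show "\<mu> ^ (n - Suc P) \<le> \<mu> ^ N * r ^ n" by (simp add: mult.commute)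
  next
    \<comment> \<open>The number of possible link counts is absorbed into a power of 2, whence the
      factor 2 in the condition on \<open>N\<close>.\<close>
    have "real (Suc P) \<le> 2 ^ Suc P"
      using less_exp[of "Suc P"] by (simp only: of_nat_less_iff[symmetric, where 'a = real] of_nat_power) simp
    then have "real (Suc P) * M ^ Suc P \<le> 2 ^ Suc P * M ^ Suc P"
      using M by (intro mult_right_mono) auto
    also have "\<dots> = 2 * M * (2 * M) ^ P"
      by (simp add: power_mult_distrib)
    also have "\<dots> \<le> 2 * M * ((q\<^sup>2) ^ N) ^ P"
      using N(2) M by (intro mult_left_mono power_mono) auto
    also have "\<dots> \<le> 2 * M * (q\<^sup>2) ^ n"
      using q2 M NP by (intro mult_left_mono) (auto simp flip: power_mult[of _ N] intro!: power_increasing)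
    finally show "real (Suc P) * M ^ Suc P \<le> 2 * M * (q\<^sup>2) ^ n" .
  qed (use L in auto)
  also have "\<dots> = L * \<mu> ^ N * r ^ n + 6 * M * q\<^sup>2 * (q ^ 4) ^ n"
    by (simp add: algebra_simps flip: power_mult power_add)
  finally show ?thesis .
qed

text \<open>The least bound \<open>R\<close> valid for all shifts is attained. If it exceeded 1,
  contraction at windows would give a smaller bound for all shifts.\<close>

lemma rate_le_1:
  assumes window: "infinite {k. (\<Inter>i\<in>{k..k+l}. kerB m (\<omega> i)) = {zeroB}}"
  shows "rate_le 0 k 1"
proof -
  define S where "S = {r. 1 \<le> r \<and> (\<forall>k. rate_le 0 k r)}"
  have "real nlet + 1 \<in> S"
    unfolding S_def rate_le_def
  proof (safe intro!: exI[of _ 3])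
    fix k \<mu> n assume "real nlet + 1 < \<mu>"
    then have "3 * (real nlet + 1) ^ n \<le> 3 * \<mu> ^ n"
      by (intro mult_left_mono power_mono) auto
    moreover have "real (card (lev_ball 0 k n)) \<le> real (3 * (nlet + 1) ^ n)"
      by (intro of_nat_mono card_lev_ball_0)
    ultimately show "real (card (lev_ball 0 k n)) \<le> 3 * \<mu> ^ n"
      by (simp add: add.commute)
  qed auto
  then have S: "S \<noteq> {}" "bdd_below S"
    by (blast, auto simp: S_def intro: bdd_belowI[of _ 1])
  define R where "R = Inf S"
  have R1: "R \<ge> 1"
    unfolding R_def using S(1) by (intro cInf_greatest) (auto simp: S_def)
  have R: "rate_le 0 k R" for k
    unfolding rate_le_def
  proof (intro allI impI)
    fix \<mu> assume "R < \<mu>"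
    then obtain r where "r \<in> S" "r < \<mu>"
      using cInf_lessD[OF S(1)] by (auto simp: R_def)
    then show "\<exists>K. \<forall>n. real (card (lev_ball 0 k n)) \<le> K * \<mu> ^ n"
      by (auto simp: S_def rate_le_def)
  qed
  have "R = 1"
  proof (rule ccontr)
    assume "R \<noteq> 1"
    then have R2: "R > 1" using R1 by simp
    \<comment> \<open>The words with few links grow like (q ^ 4) ^ n, and q ^ 4 is placed halfway
      between 1 and \<open>R\<close>.\<close>
    define q where "q = root 4 ((1 + R) / 2)"
    have q: "q > 1" "q ^ 4 = (1 + R) / 2"
      using R2 by (auto simp: q_def)
    have "\<exists>K\<ge>1. \<forall>n. (162 * (real n + 1)) ^ expo (Suc l) \<le> K * q ^ n"
      by (rule poly_le_exp[OF q(1)]) simp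
    then obtain K where K: "K \<ge> 1" "\<And>n. (162 * (real n + 1)) ^ expo (Suc l) \<le> K * q ^ n"
      by blast
    define M where "M = nlet * K * (q / (q - 1))"
    obtain N0 where N0: "2 * M < (q\<^sup>2) ^ N0"
      using real_arch_pow[of "q\<^sup>2" "2 * M"] q(1) by (auto simp: one_less_power)
    define N where "N = Suc N0"
    have "(q\<^sup>2) ^ N0 \<le> (q\<^sup>2) ^ N"
      using q(1) by (intro power_increasing) (auto simp: N_def)
    then have N: "N > 0" "2 * M \<le> (q\<^sup>2) ^ N"
      using N0 by (auto simp: N_def)
    \<comment> \<open>With \<open>\<mu>\<close> = R * t and r = R / t, the condition on
      \<open>\<mu>\<close> and \<open>r\<close> in \<open>contraction\<close> amounts to t ^ (2 * N
      - 1) \<le> R. So \<open>\<mu>\<close> may exceed \<open>R\<close> while \<open>r\<close> stays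
      below it.\<close>
    define t where "t = root (2 * N) R"
    have t: "t > 1" "t ^ (2 * N) = R"
      using R2 N by (auto simp: t_def)
    have tR: "t \<le> R"
      using power_increasing[of 1 "2 * N" t] t N by simp
    define r where "r = R / t"
    define \<mu> where "\<mu> = R * t"
    have r: "r \<ge> 1" "r < R" using t tR R2 by (auto simp: r_def field_simps)
    have "\<mu> > R" using t(1) R2 by (simp add: \<mu>_def)
    then have \<mu>: "\<mu> > R" "\<mu> \<ge> 1" using R2 by auto
    have \<mu>r: "\<mu> ^ (N - 1) \<le> r ^ N"
    proof -
      have "t ^ (N - 1) * t ^ N \<le> t ^ (2 * N)"
        using t(1) unfolding power_add[symmetric] by (intro power_increasing) auto
      then have "R ^ (N - 1) * (t ^ (N - 1) * t ^ N) \<le> R ^ (N - 1) * R"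
        using t(2) R2 by (intro mult_left_mono) auto
      also have "R ^ (N - 1) * R = R ^ N" by (simp add: N_def)
      finally show ?thesis
        using t(1) unfolding r_def \<mu>_def power_mult_distrib power_divide
        by (simp only: pos_le_divide_eq zero_less_power mult.assoc)
    qed
    \<comment> \<open>None of the quantities entering \<open>\<rho>\<close> depends on a shift, so
      the improved bound is uniform.\<close>
    define \<rho> where "\<rho> = max ((1 + R) / 2) r"
    have \<rho>: "\<rho> \<ge> 1" "\<rho> < R" "q ^ 4 \<le> \<rho>" "r \<le> \<rho>"
      unfolding q(2) using r R2 by (auto simp: \<rho>_def)
    have "rate_le 0 k \<rho>" for k
    proof -
      \<comment> \<open>Some window starts after \<open>k\<close>; the bound obtained there is
        carried back to \<open>k\<close>.\<close>
      obtain k' where "\<not> k' \<le> k" and k'_window: "(\<Inter>i\<in>{k'..k'+l}. kerB m (\<omega> i)) = {zeroB}"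
        using window by (simp only: finite_nat_set_iff_bounded_le) blast
      then have k': "k' \<ge> k" by simp
      have "rate_le (l + 2) k' R"
        by (rule rate_le_shift[OF R1 R])
      then obtain L where L: "\<And>n. real (card (lev_ball (l + 2) k' n)) \<le> L * \<mu> ^ n"
        using \<mu>(1) unfolding rate_le_def by blast
      have inc: "real (card (inc_words (l + 2) k' n)) \<le> K * q ^ n" for n
      proof -
        have "real (card (inc_words (l + 2) k' n)) \<le> real ((162 * (n + 1)) ^ expo (Suc l))"
          by (intro of_nat_mono card_inc_words k'_window)
        also have "\<dots> = (162 * (real n + 1)) ^ expo (Suc l)"
          by (simp only: of_nat_power of_nat_mult of_nat_add of_nat_numeral of_nat_1)
        finally show ?thesis using K(2)[of n] by linarith
      qed
      have L0: "L \<ge> 0" using L[of 0] by (simp add: order_trans[OF of_nat_0_le_iff])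
      have M0: "M \<ge> 0" using K(1) q(1) by (simp add: M_def)
      have bound: "real (card (lev_ball 0 k' n)) \<le> (L * \<mu> ^ N + 6 * M * q\<^sup>2) * \<rho> ^ n" for n
      proof -
        have "real (card (lev_ball 0 k' n)) \<le> L * \<mu> ^ N * r ^ n + 6 * M * q\<^sup>2 * (q ^ 4) ^ n"
          unfolding M_def
          using N by (intro contraction[OF q(1) K(1) inc L _ _ \<mu>(2) \<mu>r r(1)]) (auto simp: M_def)
        also have "\<dots> \<le> L * \<mu> ^ N * \<rho> ^ n + 6 * M * q\<^sup>2 * \<rho> ^ n"
          using \<rho> r q(1) L0 M0 \<mu> by (intro add_mono mult_left_mono power_mono) auto
        finally show ?thesis by (simp add: distrib_right)
      qed
      have "rate_le 0 k' \<rho>"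
        unfolding rate_le_def
      proof (intro allI impI exI)
        fix \<nu> n assume "\<rho> < \<nu>"
        then have "(L * \<mu> ^ N + 6 * M * q\<^sup>2) * \<rho> ^ n \<le> (L * \<mu> ^ N + 6 * M * q\<^sup>2) * \<nu> ^ n"
          using \<rho>(1) L0 M0 \<mu>(2) by (intro mult_left_mono power_mono) auto
        then show "real (card (lev_ball 0 k' n)) \<le> (L * \<mu> ^ N + 6 * M * q\<^sup>2) * \<nu> ^ n"
          using bound[of n] by linarith
      qed
      then have "rate_le (k' - k) k \<rho>"
        using k' by - (rule rate_le_shift[OF \<rho>(1)], simp)
      then show ?thesis by (rule rate_le_0)
    qed
    then have "\<rho> \<in> S" using \<rho>(1) by (simp add: S_def)
    then have "R \<le> \<rho>" unfolding R_def using S(2) by (rule cInf_lower)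
    then show False using \<rho>(2) by simp
  qed
  then show ?thesis using R by simp
qed

section \<open>From growth rates to word growth\<close>

lemma ball_subset: "ball (spinal_gens m \<omega>) n \<subseteq> lev_ball 0 0 n"
proof
  fix f assume "f \<in> ball (spinal_gens m \<omega>) n"
  then obtain gs where f: "f = foldr (\<circ>) gs id" "set gs \<subseteq> spinal_gens m \<omega>" "length gs \<le> n"
    by (auto simp: ball_def)
  have gen: "g \<in> lev_ball 0 0 1" if g: "g \<in> spinal_gens m \<omega>" for g
  proof -
    have "beta \<omega> 0 b \<in> lev_ball 0 0 1" if "b \<in> Bset m" for b
      using ev_lev_ball[of "[(L3, b)]" 0 0] that by (simp add: conjB_L3 del: lev_ball.simps)
    moreover have "rooted s \<in> lev_ball 0 0 1" for s
      using rooted_lev_ball lev_ball_mono[of 0 1 0 0] by blast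
    ultimately show ?thesis using g unfolding spinal_gens_def by blast
  qed
  have "foldr (\<circ>) gs id \<in> lev_ball 0 0 (length gs)"
    using f(2)
  proof (induction gs)
    case Nil
    then show ?case using rooted_lev_ball[of 0 0 0] by (simp add: id_def del: lev_ball.simps)
  next
    case (Cons g gs)
    then have "g \<circ> foldr (\<circ>) gs id \<in> lev_ball 0 0 (1 + length gs)"
      by (intro lev_ball_mult gen Cons.IH) auto
    then show ?case
      unfolding foldr.simps comp_apply by (simp del: lev_ball.simps)
  qed
  then show "f \<in> lev_ball 0 0 n"
    using lev_ball_mono[OF f(3)] f(1) by blast
qed

lemma growth_le_card: "growth (spinal_gens m \<omega>) n \<le> real (card (lev_ball 0 0 n))"
  unfolding growth_def by (intro of_nat_mono card_mono finite_lev_ball ball_subset)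

text \<open>Rate 1 gives growth below a multiple of exp (1 / (2 * C)) ^ n for every
  \<open>C\<close>. Were exp n at most the growth at C * n, it would be at most a multiple of exp (n
  / 2).\<close>

lemma subexponential:
  assumes "rate_le 0 0 1"
  shows "subexponential_growth (spinal_gens m \<omega>)"
proof -
  let ?g = "growth (spinal_gens m \<omega>)"
  have "growth_le ?g (\<lambda>n. exp (real n))"
    unfolding growth_le_def
  \<comment> \<open>For n \<ge> 1 the factor 3 of \<open>card_lev_ball_0\<close> can be moved into
    the base, and x \<le> exp x.\<close>
  proof (intro exI[of _ "3 * (nlet + 1)"] conjI allI impI)
    fix n :: nat assume n: "n \<ge> 1"
    have "?g n \<le> real (3 * (nlet + 1) ^ n)"
      by (intro order_trans[OF growth_le_card] of_nat_mono card_lev_ball_0)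
    also have "\<dots> \<le> real (3 ^ n * (nlet + 1) ^ n)"
      using n power_increasing[of 1 n "3::nat"] by (intro of_nat_mono mult_right_mono) auto
    also have "\<dots> = real (3 * (nlet + 1)) ^ n"
      by (simp only: of_nat_mult of_nat_power power_mult_distrib)
    also have "\<dots> \<le> exp (real (3 * (nlet + 1))) ^ n"
      using exp_ge_add_one_self[of "real (3 * (nlet + 1))"] by (intro power_mono) linarith+
    also have "\<dots> = exp (real (3 * (nlet + 1) * n))"
      by (simp add: mult.commute flip: exp_of_nat_mult)
    finally show "?g n \<le> exp (real (3 * (nlet + 1) * n))" .
  qed simp
  moreover have "\<not> growth_le (\<lambda>n. exp (real n)) ?g"
  proof
    assume "growth_le (\<lambda>n. exp (real n)) ?g"
    then obtain C :: nat where C: "C > 0" "\<And>n. n \<ge> 1 \<Longrightarrow> exp (real n) \<le> ?g (C * n)"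
      unfolding growth_le_def by blast
    obtain K where K: "\<And>n. real (card (lev_ball 0 0 n)) \<le> K * exp (1 / (2 * C)) ^ n"
      using assms C(1) unfolding rate_le_def by (metis one_less_exp_iff divide_pos_pos mult_pos_pos
        of_nat_0_less_iff zero_less_numeral zero_less_one)
    have bound: "1 + real n / 2 \<le> K" if "n \<ge> 1" for n :: nat
    proof -
      have "exp (real n) \<le> K * exp (1 / (2 * C)) ^ (C * n)"
        using C(2)[OF that] growth_le_card[of "C * n"] K[of "C * n"] by linarith
      also have "exp (1 / (2 * C)) ^ (C * n) = exp (real n / 2)"
        using C(1) by (simp flip: exp_of_nat_mult)
      finally have "exp (real n / 2) * exp (real n / 2) \<le> K * exp (real n / 2)"
        by (simp flip: exp_add)
      then have "exp (real n / 2) \<le> K" by simp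
      then show ?thesis using exp_ge_add_one_self[of "real n / 2"] by linarith
    qed
    obtain n :: nat where "real n > 2 * K" using reals_Archimedean2 by blast
    then show False using bound[of "Suc n"] by (simp add: field_simps)
  qed
  ultimately show ?thesis
    by (simp add: subexponential_growth_def growth_equiv_def)
qed

end

theorem mainTheorem1:
  fixes m :: nat and \<omega> :: "nat \<Rightarrow> (nat \<Rightarrow> nat) \<Rightarrow> nat"
  assumes epi: "\<And>i. is_epi m (\<omega> i)"
    and tail: "\<And>k. (\<Inter>i\<in>{k..}. kerB m (\<omega> i)) = {zeroB}"
    and window: "\<exists>l. infinite {k. (\<Inter>i\<in>{k..k+l}. kerB m (\<omega> i)) = {zeroB}}"
  shows "subexponential_growth (spinal_gens m \<omega>)"
proof -
  interpret spinal m \<omega>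
    by unfold_locales (rule epi)
  show ?thesis
    using window rate_le_1 subexponential by blast
qed

end
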